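(* Let $p\ge3$. The wedge product $\mathcal{W}_{p,1}=C_p\triangleleft\Delta_1$ of dimension $2+p$ has a realization in $\mathbb{R}^{2+p}$ such that all the faces corresponding to the surface $\Sigma_{p,4}\subset\mathcal{W}_{p,1}$ are preserved by the projection to the last four coordinates, and likewise by the projection to the last three coordinates. This realizes $\Sigma_{p,4}$ as a subcomplex of a polytope boundary in $\mathbb{R}^4$, and as an embedded polyhedral surface in $\mathbb{R}^3$.
   Context: Notation: $[n]=\{0,1,\dots,n-1\}$. Let $C_p=\{x\in\mathbb{R}^2 : a_ix\le1,\ i\in[p]\}$ be a convex $p$-gon with its $p$ edges labeled in cyclic order, and $\Delta_1=\{y\in\mathbb{R} : b_jy\le1,\ j\in[2]\}$ an interval (a $1$-simplex), both given by their facet inequalities. The wedge product is the simple polytope $$\mathcal{W}_{p,1}=C_p\triangleleft\Delta_1=\{(x,y_0,\dots,y_{p-1})\in\mathbb{R}^{2+p} : a_ix+b_jy_i\le1\ \text{for all } i\in[p],\ j\in[2]\},$$ with $2p$ facets, having facet hyperplanes $h_{i,j}: a_ix+b_jy_i=1$. A face $G$ is denoted by the vector $(H_0,\dots,H_{p-1})$, $H_i\subseteq[2]$, where $j\in H_i\iff G\subset h_{i,j}$. A realization of $\mathcal{W}_{p,1}$ is a polytope combinatorially equivalent to it; faces of the realization correspond to faces of $\mathcal{W}_{p,1}$ under the combinatorial equivalence. $\Sigma_{p,4}$ is the polytopal subcomplex of the boundary of $\mathcal{W}_{p,1}$ consisting of all faces $(\{j_0\},\dots,\{j_{p-1}\})$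 with $j_k\in[2]$ (all of these are $p$-gons), together with all their edges and vertices. It is a closed connected orientable $2$-manifold composed of $p$-gons with all vertices of degree $4$. Preserved faces: let $P\subset\mathbb{R}^d$ be a polytope and $\pi:\mathbb{R}^d\to\mathbb{R}^k$ an affine projection. A non-empty face $F$ of $P$ is preserved by $\pi$ if (D1) $\pi(F)$ is a face of $\pi(P)$, (D2) $\pi(F)$ is combinatorially equivalent to $F$, and (D3) $\pi^{-1}(\pi(F))\cap P=F$.
   Formalization: For the last three coordinates, "preserved" is taken relative to the realized surface instead of the whole polytope (also at p=3), since for p≥4 a surface of positive genus cannot consist of faces of a 3-polytope; the embedding in R^3 is proved in full. *)

theory Defs
  imports "HOL-Analysis.Analysis"
begin

text \<open>
  Coordinates of \<open>real ^ 'n\<close> are numbered \<open>0, 1, \<dots>, CARD('n) - 1\<close> along the linear order of the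
  index type, so that ``the last four coordinates'' makes sense for a dimension that is a parameter.
\<close>

definition coord :: "nat \<Rightarrow> real ^ 'n::{finite,linorder} \<Rightarrow> real" where
  "coord k v = v $ (sorted_list_of_set (UNIV :: 'n set) ! k)"

definition last4 :: "real ^ 'n::{finite,linorder} \<Rightarrow> real ^ 4" where
  "last4 v = vector [coord (CARD('n) - 4) v, coord (CARD('n) - 3) v,
                     coord (CARD('n) - 2) v, coord (CARD('n) - 1) v]"

definition last3 :: "real ^ 'n::{finite,linorder} \<Rightarrow> real ^ 3" where
  "last3 v = vector [coord (CARD('n) - 3) v, coord (CARD('n) - 2) v, coord (CARD('n) - 1) v]"


section \<open>Combinatorial equivalence and polytopal complexes\<close>

definition inclusion_iso :: "('a set \<Rightarrow> 'b set) \<Rightarrow> 'a set set \<Rightarrow> 'b set set \<Rightarrow> bool" where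
  "inclusion_iso \<phi> C D \<longleftrightarrow>
     bij_betw \<phi> C D \<and> (\<forall>F\<in>C. \<forall>G\<in>C. F \<subseteq> G \<longleftrightarrow> \<phi> F \<subseteq> \<phi> G)"

definition face_lattice :: "'a::real_vector set \<Rightarrow> 'a set set" where
  "face_lattice P = {F. F face_of P}"

definition comb_equivalent :: "'a::real_vector set \<Rightarrow> 'b::real_vector set \<Rightarrow> bool" where
  "comb_equivalent P Q \<longleftrightarrow> (\<exists>\<phi>. inclusion_iso \<phi> (face_lattice P) (face_lattice Q))"

definition boundary_complex :: "'a::real_vector set \<Rightarrow> 'a set set" where
  "boundary_complex P = {F. F face_of P \<and> F \<noteq> {} \<and> F \<noteq> P}"

text \<open>Complexes are represented by their non-empty faces only.\<close>

definition polytopal_complex :: "'a::real_vector set set \<Rightarrow> bool" where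
  "polytopal_complex C \<longleftrightarrow>
     finite C \<and>
     (\<forall>F\<in>C. polytope F \<and> F \<noteq> {}) \<and>
     (\<forall>F\<in>C. \<forall>G. G face_of F \<and> G \<noteq> {} \<longrightarrow> G \<in> C) \<and>
     (\<forall>F\<in>C. \<forall>G\<in>C. F \<inter> G face_of F \<and> F \<inter> G face_of G)"


section \<open>Preserved faces\<close>

definition preserved ::
    "('a::real_vector \<Rightarrow> 'b::real_vector) \<Rightarrow> 'a set \<Rightarrow> 'a set \<Rightarrow> bool" where
  "preserved \<pi> P F \<longleftrightarrow>
     F face_of P \<and> F \<noteq> {} \<and>
     \<pi> ` F face_of \<pi> ` P \<and>
     comb_equivalent (\<pi> ` F) F \<and>
     \<pi> -` (\<pi> ` F) \<inter> P = F"

text \<open>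
  The same three conditions with the polytope \<open>P\<close> replaced by a complex \<open>C\<close>: the image of \<open>F\<close> fits
  face-to-face into the image of \<open>C\<close>, it is combinatorially equivalent to \<open>F\<close>, and no point of
  \<open>\<Union>C\<close> outside \<open>F\<close> is mapped into it.  This is the notion to use for projections to
  \<open>\<real>\<^sup>3\<close>: a closed surface other than the sphere cannot consist of faces of a 3-polytope, so
  there the first and third condition cannot refer to all of \<open>P\<close>.
\<close>

definition preserved_in_complex ::
    "('a::real_vector \<Rightarrow> 'b::real_vector) \<Rightarrow> 'a set set \<Rightarrow> 'a set \<Rightarrow> bool" where
  "preserved_in_complex \<pi> C F \<longleftrightarrow>
     F \<in> C \<and> F \<noteq> {} \<and>
     (\<forall>G\<in>C. \<pi> ` F \<inter> \<pi> ` G face_of \<pi> ` F \<and> \<pi> ` F \<inter> \<pi> ` G face_of \<pi> ` G) \<and>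
     comb_equivalent (\<pi> ` F) F \<and>
     \<pi> -` (\<pi> ` F) \<inter> \<Union>C = F"


section \<open>The wedge product and its surface\<close>

definition facet_presentation :: "nat \<Rightarrow> (nat \<Rightarrow> 'a::euclidean_space) \<Rightarrow> 'a set \<Rightarrow> bool" where
  "facet_presentation m c P \<longleftrightarrow>
     P = {x. \<forall>i<m. c i \<bullet> x \<le> 1} \<and>
     bounded P \<and>
     (\<forall>i<m. {x\<in>P. c i \<bullet> x = 1} facet_of P) \<and>
     inj_on (\<lambda>i. {x\<in>P. c i \<bullet> x = 1}) {..<m}"

text \<open>For \<open>p \<ge> 3\<close>, two edges of a polygon meet iff they are adjacent, so the last condition says
  that the edges are labelled in cyclic order.\<close>

definition cyclic_polygon :: "nat \<Rightarrow> (nat \<Rightarrow> real ^ 2) \<Rightarrow> bool" where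
  "cyclic_polygon p a \<longleftrightarrow>
     (let C = {x. \<forall>i<p. a i \<bullet> x \<le> 1} in
        facet_presentation p a C \<and>
        (\<forall>i<p. {x\<in>C. a i \<bullet> x = 1} \<inter> {x\<in>C. a (Suc i mod p) \<bullet> x = 1} \<noteq> {}))"

definition interval_presentation :: "(nat \<Rightarrow> real) \<Rightarrow> bool" where
  "interval_presentation b \<longleftrightarrow> facet_presentation 2 b {y. \<forall>j<2. b j * y \<le> 1}"

text \<open>A point \<open>(x, y\<^sub>0, \<dots>, y\<^sub>p\<^sub>-\<^sub>1)\<close> of \<open>\<real>\<^sup>2\<^sup>+\<^sup>p\<close> has \<open>x\<close> as its coordinates \<open>0, 1\<close>
  and \<open>y\<^sub>i\<close> as its coordinate \<open>2 + i\<close>.\<close>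

definition wedge_form ::
    "(nat \<Rightarrow> real ^ 2) \<Rightarrow> (nat \<Rightarrow> real) \<Rightarrow> nat \<Rightarrow> nat \<Rightarrow> real ^ 'n::{finite,linorder} \<Rightarrow> real" where
  "wedge_form a b i j v = a i \<bullet> vector [coord 0 v, coord 1 v] + b j * coord (2 + i) v"

definition wedge_product ::
    "nat \<Rightarrow> (nat \<Rightarrow> real ^ 2) \<Rightarrow> (nat \<Rightarrow> real) \<Rightarrow> (real ^ 'n::{finite,linorder}) set" where
  "wedge_product p a b = {v. \<forall>i<p. \<forall>j<2. wedge_form a b i j v \<le> 1}"

definition wedge_hyperplane ::
    "(nat \<Rightarrow> real ^ 2) \<Rightarrow> (nat \<Rightarrow> real) \<Rightarrow> nat \<Rightarrow> nat \<Rightarrow> (real ^ 'n::{finite,linorder}) set" where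
  "wedge_hyperplane a b i j = {v. wedge_form a b i j v = 1}"

text \<open>The entry \<open>H\<^sub>i\<close> of the vector denoting the face \<open>G\<close>.\<close>

definition face_vector ::
    "(nat \<Rightarrow> real ^ 2) \<Rightarrow> (nat \<Rightarrow> real) \<Rightarrow> (real ^ 'n::{finite,linorder}) set \<Rightarrow> nat \<Rightarrow> nat set" where
  "face_vector a b G i = {j. j < 2 \<and> G \<subseteq> wedge_hyperplane a b i j}"

definition surface_polygons ::
    "nat \<Rightarrow> (nat \<Rightarrow> real ^ 2) \<Rightarrow> (nat \<Rightarrow> real) \<Rightarrow> (real ^ 'n::{finite,linorder}) set set" where
  "surface_polygons p a b =
     {F. F face_of wedge_product p a b \<and> F \<noteq> {} \<and> (\<forall>i<p. \<exists>j<2. face_vector a b F i = {j})}"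

definition wedge_surface ::
    "nat \<Rightarrow> (nat \<Rightarrow> real ^ 2) \<Rightarrow> (nat \<Rightarrow> real) \<Rightarrow> (real ^ 'n::{finite,linorder}) set set" where
  "wedge_surface p a b = {G. G \<noteq> {} \<and> (\<exists>F\<in>surface_polygons p a b. G face_of F)}"

end

theory Submission
  imports Defs
begin

text \<open>
  The face lattice of \<open>{z. \<forall>r\<in>R. f r z \<le> 1}\<close> is determined by the family of tight sets
  \<open>{r \<in> R. f r z = 1}\<close> of its points.  Since \<open>C\<^sub>p\<close> is simple, replacing the inequalities
  \<open>a\<^sub>i x + b\<^sub>j y\<^sub>i \<le> 1\<close> by \<open>a\<^sub>i x + b\<^sub>j y\<^sub>i + (\<Sum>k<i. l\<^sub>i\<^sub>k y\<^sub>k) \<le> 1\<close> with all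
  \<open>l\<^sub>i\<^sub>k\<close> small does not change this family: compactness shows that no new tight sets appear, and
  Brouwer's theorem produces a point with each of the old ones.

  The realization uses the coordinates \<open>(y\<^sub>0, \<dots>, y\<^sub>p\<^sub>-\<^sub>1, x)\<close>, so that the projection to the
  last four coordinates forgets \<open>y\<^sub>0, \<dots>, y\<^sub>p\<^sub>-\<^sub>3\<close>.  The \<open>l\<^sub>i\<^sub>k\<close> are chosen such that for every
  choice of one facet per edge of \<open>C\<^sub>p\<close> some positive combination of the \<open>p\<close> normals vanishes on
  \<open>y\<^sub>0, \<dots>, y\<^sub>p\<^sub>-\<^sub>3\<close> and is negative on \<open>y\<^sub>p\<^sub>-\<^sub>2\<close>.  It supports the image of the corresponding
  polygon in \<open>\<real>\<^sup>4\<close>, so all polygons survive the projection, and they lie in the lower hull with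
  respect to \<open>y\<^sub>p\<^sub>-\<^sub>2\<close>, so forgetting \<open>y\<^sub>p\<^sub>-\<^sub>2\<close> as well is injective on the surface.
\<close>

section \<open>Faces and tight sets\<close>

definition feasible :: "('r \<Rightarrow> 'v \<Rightarrow> real) \<Rightarrow> 'r set \<Rightarrow> 'v set" where
  "feasible f R = {z. \<forall>r\<in>R. f r z \<le> 1}"

definition tight :: "('r \<Rightarrow> 'v \<Rightarrow> real) \<Rightarrow> 'r set \<Rightarrow> 'v \<Rightarrow> 'r set" where
  "tight f R z = {r \<in> R. f r z = 1}"

lemma eventually_at_right_mult_less:
  fixes c d :: real
  assumes "d > 0"
  shows "\<forall>\<^sub>F e in at_right 0. c * e < d"
proof -
  have "((\<lambda>e. c * e) \<longlongrightarrow> c * 0) (at_right 0)"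
    by (intro tendsto_intros)
  then show ?thesis
    using assms by (intro order_tendstoD(2)[of _ 0]) simp_all
qed

lemma convex_feasible:
  fixes f :: "'r \<Rightarrow> 'v::real_vector \<Rightarrow> real"
  assumes "\<And>r. r \<in> R \<Longrightarrow> linear (f r)"
  shows "convex (feasible f R)"
proof -
  have "feasible f R = (\<Inter>r\<in>R. f r -` {..1})"
    by (auto simp: feasible_def)
  moreover have "convex (f r -` {..1})" if "r \<in> R" for r
    using that assms convex_linear_vimage[of "f r" "{..1}"] by auto
  ultimately show ?thesis
    by (auto intro: convex_INT)
qed

text \<open>Constraints tight at \<open>z\<close> are tight at \<open>w\<close> too, hence constant
  along the line through both, while all others have room at \<open>z\<close>. So the segment from
  \<open>w\<close> to \<open>z\<close> can be prolonged a little beyond \<open>z\<close>, and the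
  face property applied at \<open>z\<close> yields \<open>w\<close>.\<close>

lemma mem_face_if_tight_superset:
  fixes f :: "'r \<Rightarrow> 'v::real_vector \<Rightarrow> real"
  assumes "finite R" and lin: "\<And>r. r \<in> R \<Longrightarrow> linear (f r)"
    and F: "F face_of feasible f R" and z: "z \<in> F" and w: "w \<in> feasible f R"
    and sub: "tight f R z \<subseteq> tight f R w"
  shows "w \<in> F"
proof (cases "w = z")
  case False
  have zP: "z \<in> feasible f R"
    using F z face_of_imp_subset by blast
  have "\<forall>\<^sub>F t in at_right 0. \<forall>r\<in>R. f r z + t * (f r z - f r w) \<le> 1"
    using \<open>finite R\<close>
  proof (rule eventually_ball_finite, intro ballI)
    fix r assume r: "r \<in> R"
    show "\<forall>\<^sub>F t in at_right 0. f r z + t * (f r z - f r w) \<le> 1"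
    proof (cases "f r z = 1")
      case True
      then have "f r w = 1"
        using sub r by (auto simp: tight_def)
      with True show ?thesis by simp
    next
      case False
      then have "1 - f r z > 0"
        using zP r by (force simp: feasible_def)
      from eventually_at_right_mult_less[OF this, of "f r z - f r w"] show ?thesis
        by eventually_elim (simp add: mult.commute)
    qed
  qed
  then have "\<forall>\<^sub>F t in at_right 0. (\<forall>r\<in>R. f r z + t * (f r z - f r w) \<le> 1) \<and> t > 0"
    using eventually_at_right_less[of "0::real"] by eventually_elim auto
  then obtain t where t: "\<forall>r\<in>R. f r z + t * (f r z - f r w) \<le> 1" "t > 0"
    using eventually_happens trivial_limit_at_right_real by blast
  define w' where "w' = z + t *\<^sub>R (z - w)"
  have "w' \<in> feasible f R"
    using t lin by (auto simp: feasible_def w'_def linear_add linear_diff linear_scale)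
  moreover have "z \<in> open_segment w w'"
  proof -
    have eq: "z = (1 - 1 / (1 + t)) *\<^sub>R w + (1 / (1 + t)) *\<^sub>R w'"
    proof -
      have "(1 + t) *\<^sub>R z = (1 + t) *\<^sub>R ((1 - 1 / (1 + t)) *\<^sub>R w + (1 / (1 + t)) *\<^sub>R w')"
        using \<open>t > 0\<close>
        by (simp add: w'_def scaleR_right_distrib right_diff_distrib distrib_left)
          (simp add: algebra_simps)
      then show ?thesis
        using \<open>t > 0\<close> by (simp only: scaleR_cancel_left) auto
    qed
    have "w \<noteq> w'"
    proof
      assume "w = w'"
      then have "(1 + t) *\<^sub>R (z - w) = 0"
        by (simp add: w'_def algebra_simps)
      then show False
        using \<open>t > 0\<close> False by auto
    qed
    then show ?thesis
      using eq \<open>t > 0\<close> unfolding in_segment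
      by (intro conjI exI[of _ "1 / (1 + t)"]) auto
  qed
  ultimately show ?thesis
    using face_ofD[OF F] z w by blast
qed (use z in simp)

text \<open>A point of \<open>F\<close> with the fewest tight constraints replaces a relative
  interior point: its midpoint with any \<open>w\<close> in \<open>F\<close> is tight only where
  both are, so by minimality all constraints tight at \<open>z\<close> are tight at
  \<open>w\<close>.\<close>

lemma face_eq_tight_superset:
  fixes f :: "'r \<Rightarrow> 'v::real_vector \<Rightarrow> real"
  assumes "finite R" and lin: "\<And>r. r \<in> R \<Longrightarrow> linear (f r)"
    and F: "F face_of feasible f R" and "F \<noteq> {}"
  obtains z where "z \<in> F" "F = {w \<in> feasible f R. tight f R z \<subseteq> tight f R w}"
proof -
  obtain z where z: "z \<in> F" and min: "\<And>w. w \<in> F \<Longrightarrow> card (tight f R z) \<le> card (tight f R w)"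
    using \<open>F \<noteq> {}\<close> ex_has_least_nat[of "\<lambda>z. z \<in> F" _ "\<lambda>z. card (tight f R z)"] by blast
  have sub: "F \<subseteq> feasible f R"
    using F face_of_imp_subset by blast
  have "tight f R z \<subseteq> tight f R w" if w: "w \<in> F" for w
  proof -
    define m where "m = (1/2) *\<^sub>R z + (1/2) *\<^sub>R w"
    have m: "m \<in> F"
      using face_of_imp_convex[OF F] z w by (auto simp: m_def convex_def)
    have fm: "f r m = f r z / 2 + f r w / 2" if "r \<in> R" for r
      using lin[OF that] by (simp add: m_def linear_add linear_scale)
    have "tight f R m \<subseteq> tight f R z \<inter> tight f R w"
    proof
      fix r assume r: "r \<in> tight f R m"
      then have "f r z \<le> 1" "f r w \<le> 1" "f r z / 2 + f r w / 2 = 1"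
        using sub z w fm by (auto simp: tight_def feasible_def)
      then show "r \<in> tight f R z \<inter> tight f R w"
        using r by (auto simp: tight_def)
    qed
    moreover have "finite (tight f R z)"
      using \<open>finite R\<close> by (auto simp: tight_def)
    ultimately have "tight f R m = tight f R z"
      using min[OF m] by (intro card_seteq) auto
    with \<open>tight f R m \<subseteq> _\<close> show ?thesis
      by blast
  qed
  then have "F = {w \<in> feasible f R. tight f R z \<subseteq> tight f R w}"
    using mem_face_if_tight_superset[OF assms(1,2,3) z] sub by blast
  with z show thesis
    using that by blast
qed

lemma tight_superset_face_of:
  fixes f :: "'r \<Rightarrow> 'v::real_vector \<Rightarrow> real"
  assumes lin: "\<And>r. r \<in> R \<Longrightarrow> linear (f r)" and "I \<subseteq> R"
  shows "{w \<in> feasible f R. I \<subseteq> tight f R w} face_of feasible f R"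
proof -
  have "{w \<in> feasible f R. I \<subseteq> tight f R w}
      = feasible f R \<inter> (\<Inter>r\<in>I. f r -` {1})"
    using \<open>I \<subseteq> R\<close> by (auto simp: tight_def)
  moreover have "convex (f r -` {1})" if "r \<in> I" for r
    using that assms convex_linear_vimage[of "f r" "{1}"] by auto
  ultimately have "convex {w \<in> feasible f R. I \<subseteq> tight f R w}"
    using convex_feasible[of R f] lin by (simp add: convex_Int convex_INT)
  moreover have "v \<in> {w \<in> feasible f R. I \<subseteq> tight f R w} \<and> w \<in> {w \<in> feasible f R. I \<subseteq> tight f R w}"
    if v: "v \<in> feasible f R" and w: "w \<in> feasible f R"
      and x: "x \<in> {w \<in> feasible f R. I \<subseteq> tight f R w}" "x \<in> open_segment v w" for v w x
  proof -
    obtain u where u: "0 < u" "u < 1" "x = (1 - u) *\<^sub>R v + u *\<^sub>R w"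
      using x(2) by (auto simp: in_segment)
    have "f r v = 1 \<and> f r w = 1" if r: "r \<in> I" for r
    proof -
      have "(1 - u) * f r v + u * f r w = 1"
        using x(1) r \<open>I \<subseteq> R\<close> lin[of r] u(3) by (auto simp: tight_def linear_add linear_scale)
      then have *: "(1 - u) * (1 - f r v) + u * (1 - f r w) = 0"
        by (simp add: algebra_simps)
      have "f r v \<le> 1" "f r w \<le> 1"
        using v w r \<open>I \<subseteq> R\<close> by (auto simp: feasible_def)
      then have "(1 - u) * (1 - f r v) \<ge> 0" "u * (1 - f r w) \<ge> 0"
        using u by auto
      with * have "(1 - u) * (1 - f r v) = 0" "u * (1 - f r w) = 0"
        by linarith+
      then show ?thesis
        using u by auto
    qed
    then show ?thesis
      using v w \<open>I \<subseteq> R\<close> by (auto simp: tight_def)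
  qed
  ultimately show ?thesis
    unfolding face_of_def by blast
qed

section \<open>Face isomorphisms from equal families of tight sets\<close>

definition tight_transfer ::
    "('r \<Rightarrow> 'v \<Rightarrow> real) \<Rightarrow> ('r \<Rightarrow> 'w \<Rightarrow> real) \<Rightarrow> 'r set \<Rightarrow> 'v set \<Rightarrow> 'w set" where
  "tight_transfer f g R F = {w \<in> feasible g R. tight g R w \<in> tight f R ` F}"

lemma tight_transfer_empty [simp]: "tight_transfer f g R {} = {}"
  by (simp add: tight_transfer_def)

text \<open>The hypothesis supplies for each point on one side a partner with the same tight set on
  the other; without it the transferred set could miss points.\<close>

lemma tight_transfer_tight_superset:
  assumes "tight f R ` feasible f R = tight g R ` feasible g R"
  shows "tight_transfer f g R {w \<in> feasible f R. I \<subseteq> tight f R w}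
       = {w \<in> feasible g R. I \<subseteq> tight g R w}"
proof -
  have "tight g R w \<in> tight f R ` feasible f R" if "w \<in> feasible g R" for w
    using that assms by blast
  then show ?thesis
    unfolding tight_transfer_def by (auto simp: image_iff) metis
qed

text \<open>By \<open>face_eq_tight_superset\<close> a nonempty face is cut out by the tight set of
  one of its points, and this description carries over in both directions.\<close>

lemma tight_transfer_face:
  fixes f :: "'r \<Rightarrow> 'v::real_vector \<Rightarrow> real" and g :: "'r \<Rightarrow> 'w::real_vector \<Rightarrow> real"
  assumes "finite R" and linf: "\<And>r. r \<in> R \<Longrightarrow> linear (f r)" and ling: "\<And>r. r \<in> R \<Longrightarrow> linear (g r)"
    and eq: "tight f R ` feasible f R = tight g R ` feasible g R"
    and F: "F face_of feasible f R"
  shows "tight_transfer f g R F face_of feasible g R"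
    and "tight_transfer g f R (tight_transfer f g R F) = F"
proof -
  have "tight_transfer f g R F face_of feasible g R
      \<and> tight_transfer g f R (tight_transfer f g R F) = F"
  proof (cases "F = {}")
    case False
    then obtain z where "z \<in> F" and z: "F = {w \<in> feasible f R. tight f R z \<subseteq> tight f R w}"
      using face_eq_tight_superset[OF \<open>finite R\<close> linf F] by blast
    have "tight f R z \<subseteq> R"
      by (auto simp: tight_def)
    then show ?thesis
      using tight_superset_face_of[of R g "tight f R z"] ling
        tight_transfer_tight_superset[OF eq, of "tight f R z"]
        tight_transfer_tight_superset[OF eq[symmetric], of "tight f R z"] z
      by metis
  qed simp
  then show "tight_transfer f g R F face_of feasible g R"
    and "tight_transfer g f R (tight_transfer f g R F) = F"
    by auto
qed

lemma inclusion_iso_tight_transfer: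
  fixes f :: "'r \<Rightarrow> 'v::real_vector \<Rightarrow> real" and g :: "'r \<Rightarrow> 'w::real_vector \<Rightarrow> real"
  assumes "finite R" and "\<And>r. r \<in> R \<Longrightarrow> linear (f r)" and "\<And>r. r \<in> R \<Longrightarrow> linear (g r)"
    and "tight f R ` feasible f R = tight g R ` feasible g R"
  shows "inclusion_iso (tight_transfer f g R)
           (face_lattice (feasible f R)) (face_lattice (feasible g R))"
proof -
  note fg = tight_transfer_face[OF assms]
  note gf = tight_transfer_face[OF assms(1,3,2) assms(4)[symmetric]]
  have mono: "F \<subseteq> G \<Longrightarrow> tight_transfer f g R F \<subseteq> tight_transfer f g R G"
    and mono': "F' \<subseteq> G' \<Longrightarrow> tight_transfer g f R F' \<subseteq> tight_transfer g f R G'" for F G F' G'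
    by (auto simp: tight_transfer_def)
  have "bij_betw (tight_transfer f g R) (face_lattice (feasible f R)) (face_lattice (feasible g R))"
    by (rule bij_betw_byWitness[where f' = "tight_transfer g f R"])
      (auto simp: face_lattice_def fg gf)
  moreover have "F \<subseteq> G"
    if "F face_of feasible f R" "G face_of feasible f R"
      "tight_transfer f g R F \<subseteq> tight_transfer f g R G" for F G
    using mono'[OF that(3)] fg(2) that by simp
  ultimately show ?thesis
    using mono unfolding inclusion_iso_def face_lattice_def by blast
qed

section \<open>Injective linear images of faces and complexes\<close>

lemma inclusion_iso_inv_into:
  assumes "inclusion_iso \<phi> C D"
  shows "inclusion_iso (inv_into C \<phi>) D C"
proof -
  have bij: "bij_betw \<phi> C D" and mono: "\<And>F G. F \<in> C \<Longrightarrow> G \<in> C \<Longrightarrow> F \<subseteq> G \<longleftrightarrow> \<phi> F \<subseteq> \<phi> G"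
    using assms by (auto simp: inclusion_iso_def)
  have "F \<subseteq> G \<longleftrightarrow> inv_into C \<phi> F \<subseteq> inv_into C \<phi> G" if "F \<in> D" "G \<in> D" for F G
  proof -
    have "inv_into C \<phi> F \<in> C" "inv_into C \<phi> G \<in> C"
      using that bij by (auto simp: bij_betw_def inv_into_into)
    then show ?thesis
      using mono[of "inv_into C \<phi> F" "inv_into C \<phi> G"] that bij
      by (auto simp: bij_betw_inv_into_right)
  qed
  then show ?thesis
    using bij by (simp add: inclusion_iso_def bij_betw_inv_into)
qed

lemma inclusion_iso_image_inj:
  assumes "inj_on \<pi> (\<Union>K)"
  shows "inclusion_iso ((`) \<pi>) K ((`) \<pi> ` K)"
proof -
  have iff: "\<pi> ` F \<subseteq> \<pi> ` G \<longleftrightarrow> F \<subseteq> G" if "F \<in> K" "G \<in> K" for F G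
    using that assms by (metis Sup_upper inj_on_image_subset_iff)
  then have "inj_on ((`) \<pi>) K"
    by (intro inj_onI) (metis order_antisym order_refl)
  then show ?thesis
    using iff by (auto simp: inclusion_iso_def bij_betw_def)
qed

text \<open>Convexity keeps combinations of points of \<open>P\<close> inside \<open>P\<close>, so
  injectivity there, rather than on the whole space, already makes \<open>\<pi>\<close> preserve and
  reflect open segments.\<close>

lemma face_of_linear_image_inj_on:
  assumes lin: "linear \<pi>" and cvx: "convex P" and inj: "inj_on \<pi> P" and F: "F \<subseteq> P"
  shows "\<pi> ` F face_of \<pi> ` P \<longleftrightarrow> F face_of P"
proof -
  have seg: "\<pi> x \<in> open_segment (\<pi> v) (\<pi> w) \<longleftrightarrow> x \<in> open_segment v w"
    if "x \<in> P" "v \<in> P" "w \<in> P" for x v w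
  proof -
    have "\<pi> x = (1 - u) *\<^sub>R \<pi> v + u *\<^sub>R \<pi> w \<longleftrightarrow> x = (1 - u) *\<^sub>R v + u *\<^sub>R w"
      if u: "0 < u" "u < 1" for u :: real
    proof -
      have "(1 - u) *\<^sub>R v + u *\<^sub>R w \<in> P"
        using cvx \<open>v \<in> P\<close> \<open>w \<in> P\<close> u by (auto simp: convex_alt)
      moreover have "\<pi> ((1 - u) *\<^sub>R v + u *\<^sub>R w) = (1 - u) *\<^sub>R \<pi> v + u *\<^sub>R \<pi> w"
        using lin by (simp add: linear_add linear_scale)
      ultimately show ?thesis
        using inj \<open>x \<in> P\<close> by (metis inj_onD)
    qed
    moreover have "\<pi> v = \<pi> w \<longleftrightarrow> v = w"
      using inj that by (metis inj_onD)
    ultimately show ?thesis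
      by (auto simp: in_segment)
  qed
  have "convex (\<pi> ` F) \<longleftrightarrow> convex F"
  proof
    assume c: "convex (\<pi> ` F)"
    have "F = P \<inter> \<pi> -` (\<pi> ` F)"
      using inj F by (auto dest: inj_onD)
    then show "convex F"
      using convex_Int[OF cvx convex_linear_vimage[OF lin c]] by simp
  qed (use lin convex_linear_image in blast)
  moreover have mem: "\<pi> v \<in> \<pi> ` F \<longleftrightarrow> v \<in> F" if "v \<in> P" for v
    using inj_on_image_mem_iff[OF inj that F] .
  have "(\<forall>v\<in>P. \<forall>w\<in>P. \<forall>x\<in>F. \<pi> x \<in> open_segment (\<pi> v) (\<pi> w) \<longrightarrow> \<pi> v \<in> \<pi> ` F \<and> \<pi> w \<in> \<pi> ` F)
      \<longleftrightarrow> (\<forall>v\<in>P. \<forall>w\<in>P. \<forall>x\<in>F. x \<in> open_segment v w \<longrightarrow> v \<in> F \<and> w \<in> F)"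
    using F by (intro ball_cong refl) (simp add: seg mem subset_iff)
  ultimately show ?thesis
    using image_mono[OF F, of \<pi>] F unfolding face_of_def ball_simps by blast
qed

lemma face_lattice_linear_image:
  assumes lin: "linear \<pi>" and "convex P" "inj_on \<pi> P"
  shows "face_lattice (\<pi> ` P) = (`) \<pi> ` face_lattice P"
proof
  show "face_lattice (\<pi> ` P) \<subseteq> (`) \<pi> ` face_lattice P"
  proof
    fix H assume "H \<in> face_lattice (\<pi> ` P)"
    then have H: "H face_of \<pi> ` P"
      by (simp add: face_lattice_def)
    then obtain F where "F \<subseteq> P" "H = \<pi> ` F"
      by (meson face_of_imp_subset subset_imageE)
    then show "H \<in> (`) \<pi> ` face_lattice P"
      using H face_of_linear_image_inj_on[OF assms] by (auto simp: face_lattice_def)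
  qed
  show "(`) \<pi> ` face_lattice P \<subseteq> face_lattice (\<pi> ` P)"
    using face_of_linear_image_inj_on[OF assms face_of_imp_subset] by (auto simp: face_lattice_def)
qed

lemma comb_equivalent_linear_image:
  assumes "linear \<pi>" "convex P" "inj_on \<pi> P"
  shows "comb_equivalent (\<pi> ` P) P"
proof -
  have "\<Union>(face_lattice P) = P"
    using face_of_refl[OF \<open>convex P\<close>] face_of_imp_subset by (auto simp: face_lattice_def)
  then have "inclusion_iso ((`) \<pi>) (face_lattice P) (face_lattice (\<pi> ` P))"
    using inclusion_iso_image_inj[of \<pi> "face_lattice P"] assms
    by (simp add: face_lattice_linear_image)
  then show ?thesis
    using inclusion_iso_inv_into unfolding comb_equivalent_def by blast
qed

text \<open>The functional exposing \<open>F\<close> factors through \<open>\<pi>\<close>, so it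
  also exposes the image of \<open>F\<close>, and no other point of \<open>P\<close> is mapped into
  that image. Injectivity on \<open>F\<close> passes this on to the faces of
  \<open>F\<close>.\<close>

lemma preserved_subface:
  fixes \<pi> :: "'a::real_vector \<Rightarrow> 'b::euclidean_space"
  assumes lin: "linear \<pi>" and "convex P" and F: "F face_of P" and inj: "inj_on \<pi> F"
    and le: "\<And>z. z \<in> P \<Longrightarrow> c \<bullet> \<pi> z \<le> m" and eq: "F = {z \<in> P. c \<bullet> \<pi> z = m}"
    and G: "G face_of F" "G \<noteq> {}"
  shows "preserved \<pi> P G"
proof -
  have sub: "G \<subseteq> F" "F \<subseteq> P"
    using F G face_of_imp_subset by auto
  have cvx: "convex F" "convex G"
    using F G face_of_imp_convex by auto
  have "\<pi> ` P \<inter> {y. c \<bullet> y = m} face_of \<pi> ` P"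
    using \<open>convex P\<close> le lin
    by (intro face_of_Int_supporting_hyperplane_le) (auto intro: convex_linear_image)
  also have "\<pi> ` P \<inter> {y. c \<bullet> y = m} = \<pi> ` F"
    using eq by auto
  finally have "\<pi> ` G face_of \<pi> ` P"
    using face_of_linear_image_inj_on[OF lin cvx(1) inj sub(1)] G face_of_trans by blast
  moreover have "comb_equivalent (\<pi> ` G) G"
    using comb_equivalent_linear_image[OF lin cvx(2)] inj sub inj_on_subset by blast
  moreover have "\<pi> -` (\<pi> ` G) \<inter> P = G"
  proof
    show "\<pi> -` (\<pi> ` G) \<inter> P \<subseteq> G"
    proof
      fix z assume z: "z \<in> \<pi> -` (\<pi> ` G) \<inter> P"
      then obtain g where g: "g \<in> G" "\<pi> z = \<pi> g" by auto
      then have "z \<in> F"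
        using z sub eq by auto
      then show "z \<in> G"
        using g inj sub by (metis inj_onD subsetD)
    qed
  qed (use sub in auto)
  ultimately show ?thesis
    using G F face_of_trans unfolding preserved_def by blast
qed

text \<open>Injectivity on the union, and not merely on each cell, makes images commute with
  intersections, so cells still meet face to face. Compactness of the union makes the inverse
  continuous.\<close>

lemma polytopal_complex_linear_image:
  fixes \<pi> :: "'a::euclidean_space \<Rightarrow> 'b::euclidean_space"
  assumes K: "polytopal_complex K" and lin: "linear \<pi>" and inj: "inj_on \<pi> (\<Union>K)"
  shows "polytopal_complex ((`) \<pi> ` K)"
    and "X \<in> K \<Longrightarrow> preserved_in_complex \<pi> K X"
    and "\<exists>g. homeomorphism (\<Union>K) (\<Union>((`) \<pi> ` K)) \<pi> g"
proof -
  have fin: "finite K" and poly: "\<And>X. X \<in> K \<Longrightarrow> polytope X \<and> X \<noteq> {}"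
    and face: "\<And>X Y. X \<in> K \<Longrightarrow> Y face_of X \<Longrightarrow> Y \<noteq> {} \<Longrightarrow> Y \<in> K"
    and Int: "\<And>X Y. X \<in> K \<Longrightarrow> Y \<in> K \<Longrightarrow> X \<inter> Y face_of X \<and> X \<inter> Y face_of Y"
    using K unfolding polytopal_complex_def by blast+
  have cvx: "convex X" and injX: "inj_on \<pi> X" if "X \<in> K" for X
    using that poly polytope_imp_convex inj inj_on_subset by blast+
  have Int': "\<pi> ` X \<inter> \<pi> ` Y face_of \<pi> ` X \<and> \<pi> ` X \<inter> \<pi> ` Y face_of \<pi> ` Y"
    if X: "X \<in> K" and Y: "Y \<in> K" for X Y
  proof -
    have "\<pi> ` X \<inter> \<pi> ` Y = \<pi> ` (X \<inter> Y)"
      using inj_on_image_Int[OF inj Sup_upper[OF X] Sup_upper[OF Y]] by simp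
    then show ?thesis
      using Int[OF X Y] face_of_linear_image_inj_on[OF lin cvx[OF X] injX[OF X], of "X \<inter> Y"]
        face_of_linear_image_inj_on[OF lin cvx[OF Y] injX[OF Y], of "X \<inter> Y"] by simp
  qed
  have "H \<in> (`) \<pi> ` K" if X: "X \<in> K" and H: "H face_of \<pi> ` X" "H \<noteq> {}" for X H
  proof -
    have "H \<in> (`) \<pi> ` face_lattice X"
      using H(1) unfolding face_lattice_linear_image[OF lin cvx[OF X] injX[OF X], symmetric]
      by (simp add: face_lattice_def)
    then obtain Y where "Y face_of X" "H = \<pi> ` Y"
      by (auto simp: face_lattice_def)
    then show ?thesis
      using face[OF X, of Y] H(2) by auto
  qed
  then show "polytopal_complex ((`) \<pi> ` K)"
    using fin poly lin Int' by (auto simp: polytopal_complex_def intro: polytope_linear_image)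
  show "preserved_in_complex \<pi> K X" if "X \<in> K"
  proof -
    have "\<pi> -` (\<pi> ` X) \<inter> \<Union>K = X"
      using inj that by (auto dest: inj_onD)
    then show ?thesis
      using that poly Int' comb_equivalent_linear_image[OF lin cvx injX]
      by (auto simp: preserved_in_complex_def)
  qed
  have "compact (\<Union>K)"
    using fin poly polytope_imp_compact by (intro compact_Union) auto
  then show "\<exists>g. homeomorphism (\<Union>K) (\<Union>((`) \<pi> ` K)) \<pi> g"
    using lin inj by (intro homeomorphism_compact)
      (auto intro: linear_continuous_on linear_conv_bounded_linear[THEN iffD1])
qed

section \<open>Small lower triangular perturbations of a wedge\<close>

text \<open>Pairs of a base point and an infinite sequence keep the perturbation argument
  independent of how coordinates are placed in \<open>real ^ 'n\<close>; only finitely many entries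
  of the sequence enter.\<close>

definition perturbed_form ::
    "(nat \<Rightarrow> 'a::real_inner) \<Rightarrow> (nat \<Rightarrow> real) \<Rightarrow> (nat \<Rightarrow> nat \<Rightarrow> real)
      \<Rightarrow> nat \<times> nat \<Rightarrow> 'a \<times> (nat \<Rightarrow> real) \<Rightarrow> real" where
  "perturbed_form a b l r z =
     a (fst r) \<bullet> fst z + b (snd r) * snd z (fst r) + (\<Sum>k<fst r. l (fst r) k * snd z k)"

text \<open>Both constraints with index \<open>i\<close> read
  \<open>b j * y i \<le> slack i\<close>, so for a nonnegative slack \<open>y i\<close> ranges over
  the interval scaled by it. The slack involves only \<open>y k\<close> with
  \<open>k < i\<close>.\<close>

definition slack ::
    "(nat \<Rightarrow> 'a::real_inner) \<Rightarrow> (nat \<Rightarrow> nat \<Rightarrow> real) \<Rightarrow> 'a \<times> (nat \<Rightarrow> real) \<Rightarrow> nat \<Rightarrow> real" where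
  "slack a l z i = 1 - a i \<bullet> fst z - (\<Sum>k<i. l i k * snd z k)"

lemma perturbed_form_slack: "perturbed_form a b l (i, j) z = 1 - slack a l z i + b j * snd z i"
  by (simp add: perturbed_form_def slack_def)

text \<open>For \<open>h > 0\<close> the coefficient \<open>\<tau>\<close> for which \<open>\<tau> h\<close> is tight for the same \<open>j\<close> as \<open>y\<close>, where
  \<open>b\<^sub>j y \<le> h\<close>; it does not refer to \<open>h\<close> and so carries the pattern over to any other slack.\<close>

definition fibre_coeff :: "(nat \<Rightarrow> real) \<Rightarrow> real \<Rightarrow> real \<Rightarrow> real" where
  "fibre_coeff b h y = (if b 0 * y = h then 1 / b 0 else if b 1 * y = h then 1 / b 1 else 0)"

text \<open>The admissible \<open>y\<close> form the interval scaled by \<open>h\<close>. For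
  \<open>h > 0\<close> the coefficient carries each end point to the corresponding end point for
  \<open>h'\<close> and all interior points to 0; for \<open>h = 0\<close> both intervals are the
  single point 0.\<close>

lemma fibre_transfer:
  fixes b :: "nat \<Rightarrow> real"
  assumes sign: "b 0 * b 1 < 0" and y: "b 0 * y \<le> h" "b 1 * y \<le> h"
    and h': "h' \<ge> 0" "h' = 0 \<longleftrightarrow> h = 0" and y': "y' = fibre_coeff b h y * h'"
    and "j < 2"
  shows "b j * y' \<le> h'" "b j * y' = h' \<longleftrightarrow> b j * y = h"
proof -
  have neg: "b 1 / b 0 < 0" "b 0 / b 1 < 0" and nz: "b 0 \<noteq> 0" "b 1 \<noteq> 0"
    using sign by (auto simp: divide_less_0_iff mult_less_0_iff)
  have "b 0 * y \<ge> 0 \<or> b 1 * y \<ge> 0"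
    using sign by (auto simp: zero_le_mult_iff mult_less_0_iff)
  then have "h \<ge> 0"
    using y by linarith
  have j: "j = 0 \<or> j = 1"
    using \<open>j < 2\<close> by auto
  have "b j * y' \<le> h' \<and> (b j * y' = h' \<longleftrightarrow> b j * y = h)"
  proof (cases "h = 0")
    case True
    have "(b 0 * y) * (b 1 * y) \<ge> 0"
      using y True by (simp add: mult_nonpos_nonpos)
    then have "(b 0 * b 1) * (y * y) \<ge> 0"
      by (simp add: mult_ac)
    then have "\<not> y * y > 0"
      using sign mult_neg_pos[of "b 0 * b 1" "y * y"] by linarith
    then have "y = 0"
      by (simp add: not_real_square_gt_zero)
    then show ?thesis
      using True h' y' by auto
  next
    case False
    then have pos: "h > 0" "h' > 0"
      using h' \<open>h \<ge> 0\<close> by auto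
    have neg': "b 1 / b 0 * h < 0" "b 0 / b 1 * h < 0" "b 1 / b 0 * h' < 0" "b 0 / b 1 * h' < 0"
      using neg pos by (simp_all add: mult_neg_pos del: times_divide_eq_left)
    consider "b 0 * y = h" | "b 0 * y \<noteq> h" "b 1 * y = h" | "b 0 * y \<noteq> h" "b 1 * y \<noteq> h"
      by blast
    then show ?thesis
    proof cases
      case 1
      then have "y = h / b 0" "y' = h' / b 0"
        using nz y' by (auto simp: fibre_coeff_def field_simps)
      then show ?thesis
        using j nz neg' pos by auto
    next
      case 2
      then have "y = h / b 1" "y' = h' / b 1"
        using nz y' by (auto simp: fibre_coeff_def field_simps)
      then show ?thesis
        using j nz neg' pos by auto
    next
      case 3
      then show ?thesis
        using j pos y' by (auto simp: fibre_coeff_def)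
    qed
  qed
  then show "b j * y' \<le> h'" "b j * y' = h' \<longleftrightarrow> b j * y = h"
    by auto
qed

text \<open>The slack at \<open>i\<close> involves only earlier entries of \<open>y\<close>, so
  prescribed ratios \<open>\<tau>\<close> determine \<open>y\<close> recursively, and continuously,
  from \<open>x\<close>.\<close>

function fibre_point ::
    "(nat \<Rightarrow> 'a::real_inner) \<Rightarrow> (nat \<Rightarrow> nat \<Rightarrow> real) \<Rightarrow> (nat \<Rightarrow> real) \<Rightarrow> 'a \<Rightarrow> nat \<Rightarrow> real" where
  "fibre_point a l \<tau> x i = \<tau> i * (1 - a i \<bullet> x - (\<Sum>k<i. l i k * fibre_point a l \<tau> x k))"
  by pat_completeness auto
termination
  by (relation "Wellfounded.measure (\<lambda>(_, _, _, _, i). i)") auto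

declare fibre_point.simps [simp del]

lemma fibre_point_slack: "fibre_point a l \<tau> x i = \<tau> i * slack a l (x, fibre_point a l \<tau> x) i"
  by (subst fibre_point.simps) (simp add: slack_def)

lemma continuous_on_fibre_point: "continuous_on S (\<lambda>x. fibre_point a l \<tau> x i)"
proof (induction i rule: less_induct)
  case (less i)
  show ?case
    by (subst fibre_point.simps) (intro continuous_intros less, simp)
qed

text \<open>Simplicity is expressed by dual vectors \<open>u j\<close>, which exist exactly when the
  normals tight at a common point are linearly independent. They serve to release chosen constraints
  and to solve for prescribed ones.\<close>

locale wedge_base =
  fixes p :: nat and a :: "nat \<Rightarrow> 'a::euclidean_space" and b :: "nat \<Rightarrow> real"
  assumes bounded_base: "bounded {x. \<forall>i<p. a i \<bullet> x \<le> 1}"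
    and simple_base: "\<And>v. \<forall>i<p. a i \<bullet> v \<le> 1 \<Longrightarrow>
      \<exists>u. \<forall>i<p. \<forall>j<p. a i \<bullet> v = 1 \<longrightarrow> a j \<bullet> v = 1 \<longrightarrow> a i \<bullet> u j = (if i = j then 1 else 0)"
    and opposite_signs: "b 0 * b 1 < 0"
begin

abbreviation constraints :: "(nat \<times> nat) set" where
  "constraints \<equiv> {..<p} \<times> {..<2}"

definition base_tight :: "'a \<Rightarrow> nat set" where
  "base_tight v = {i. i < p \<and> a i \<bullet> v = 1}"

definition base_tight_sets :: "nat set set" where
  "base_tight_sets = base_tight ` {x. \<forall>i<p. a i \<bullet> x \<le> 1}"

definition lower_small :: "(nat \<Rightarrow> nat \<Rightarrow> real) \<Rightarrow> real \<Rightarrow> bool" where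
  "lower_small l e \<longleftrightarrow> (\<forall>i<p. \<forall>k<i. \<bar>l i k\<bar> \<le> e)"

lemma finite_base_tight_sets: "finite base_tight_sets"
  by (rule finite_subset[of _ "Pow {..<p}"]) (auto simp: base_tight_sets_def base_tight_def)

lemma mem_feasible_iff:
  "z \<in> feasible (perturbed_form a b l) constraints
     \<longleftrightarrow> (\<forall>i<p. b 0 * snd z i \<le> slack a l z i \<and> b 1 * snd z i \<le> slack a l z i)"
  by (auto simp: feasible_def perturbed_form_slack less_2_cases_iff)

lemma slack_nonneg:
  assumes "z \<in> feasible (perturbed_form a b l) constraints" "i < p"
  shows "slack a l z i \<ge> 0"
proof -
  have "b 0 * snd z i \<le> slack a l z i" "b 1 * snd z i \<le> slack a l z i"
    using assms by (auto simp: mem_feasible_iff)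
  moreover have "b 0 * snd z i \<ge> 0 \<or> b 1 * snd z i \<ge> 0"
    using opposite_signs by (auto simp: zero_le_mult_iff mult_less_0_iff)
  ultimately show ?thesis
    by linarith
qed

text \<open>Applied fibre by fibre, \<open>fibre_transfer\<close> reduces equality of tight sets to
  the vanishing of the same slacks.\<close>

lemma tight_eq_fibre_coeff:
  assumes z: "z \<in> feasible (perturbed_form a b l) constraints"
    and slack': "\<And>i. i < p \<Longrightarrow> slack a l' z' i \<ge> 0 \<and> (slack a l' z' i = 0 \<longleftrightarrow> slack a l z i = 0)"
    and y': "\<And>i. i < p \<Longrightarrow>
      snd z' i = fibre_coeff b (slack a l z i) (snd z i) * slack a l' z' i"
  shows "z' \<in> feasible (perturbed_form a b l') constraints"
    and "tight (perturbed_form a b l') constraints z' = tight (perturbed_form a b l) constraints z"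
proof -
  have *: "b j * snd z' i \<le> slack a l' z' i \<and>
      (b j * snd z' i = slack a l' z' i \<longleftrightarrow> b j * snd z i = slack a l z i)"
    if "i < p" "j < 2" for i j
    using fibre_transfer[OF opposite_signs, of "snd z i" "slack a l z i" "slack a l' z' i" "snd z' i" j]
      that z slack'[OF that(1)] y'[OF that(1)] by (simp add: mem_feasible_iff)
  show "z' \<in> feasible (perturbed_form a b l') constraints"
    using * by (auto simp: mem_feasible_iff)
  show "tight (perturbed_form a b l') constraints z' = tight (perturbed_form a b l) constraints z"
    using * by (auto simp: tight_def perturbed_form_slack)
qed

text \<open>Moving from \<open>v\<close> against the sum of the dual vectors \<open>u j\<close> with
  \<open>j\<close> in \<open>T - T'\<close> releases exactly these constraints, and a small step
  keeps those outside \<open>T\<close> strict.\<close>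

lemma base_tight_sets_subset:
  assumes "T \<in> base_tight_sets" "T' \<subseteq> T"
  shows "T' \<in> base_tight_sets"
proof -
  obtain v where v: "\<forall>i<p. a i \<bullet> v \<le> 1" and T: "T = base_tight v"
    using assms(1) by (auto simp: base_tight_sets_def)
  obtain u where u: "\<And>i j. i \<in> T \<Longrightarrow> j \<in> T \<Longrightarrow> a i \<bullet> u j = (if i = j then 1 else 0)"
    using simple_base[OF v] T by (auto simp: base_tight_def)
  define d where "d = (\<Sum>j\<in>T - T'. u j)"
  have "finite T"
    by (simp add: T base_tight_def)
  have d: "a i \<bullet> d = (if i \<in> T' then 0 else 1)" if "i \<in> T" for i
    using u that \<open>finite T\<close> by (simp add: d_def inner_sum_right)
  have "\<forall>\<^sub>F t in at_right 0. \<forall>i\<in>{..<p} - T. a i \<bullet> v - t * (a i \<bullet> d) < 1"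
  proof (rule eventually_ball_finite, simp, intro ballI)
    fix i assume i: "i \<in> {..<p} - T"
    then have "1 - a i \<bullet> v > 0"
      using v T by (force simp: base_tight_def)
    from eventually_at_right_mult_less[OF this, of "- (a i \<bullet> d)"]
    show "\<forall>\<^sub>F t in at_right 0. a i \<bullet> v - t * (a i \<bullet> d) < 1"
      by eventually_elim (simp add: mult.commute)
  qed
  then have "\<forall>\<^sub>F t in at_right 0. (\<forall>i\<in>{..<p} - T. a i \<bullet> v - t * (a i \<bullet> d) < 1) \<and> t > 0"
    using eventually_at_right_less[of "0::real"] by eventually_elim auto
  then obtain t where t: "\<forall>i\<in>{..<p} - T. a i \<bullet> v - t * (a i \<bullet> d) < 1" "t > 0"
    using eventually_happens trivial_limit_at_right_real by blast
  define w where "w = v - t *\<^sub>R d"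
  have w: "a i \<bullet> w = a i \<bullet> v - t * (a i \<bullet> d)" for i
    by (simp add: w_def inner_diff_right)
  have wT: "a i \<bullet> w = (if i \<in> T' then 1 else 1 - t)" if "i \<in> T" for i
    using that d[OF that] T by (auto simp: w base_tight_def)
  have "a i \<bullet> w \<le> 1 \<and> (a i \<bullet> w = 1 \<longleftrightarrow> i \<in> T')" if "i < p" for i
    using wT[of i] t that assms(2) by (cases "i \<in> T") (force simp: w)+
  moreover have "T' \<subseteq> {..<p}"
    using assms(2) T by (auto simp: base_tight_def)
  ultimately have "base_tight w = T'" "\<forall>i<p. a i \<bullet> w \<le> 1"
    by (auto simp: base_tight_def)
  then show ?thesis
    by (auto simp: base_tight_sets_def)
qed

section \<open>Uniform bounds and absence of new tight sets\<close>

lemma bounded_base_radius: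
  obtains r where "r \<ge> 0" "\<And>x m. m > 0 \<Longrightarrow> \<forall>i<p. a i \<bullet> x \<le> m \<Longrightarrow> norm x \<le> r * m"
proof -
  obtain r where r: "\<And>x. \<forall>i<p. a i \<bullet> x \<le> 1 \<Longrightarrow> norm x \<le> r"
    using bounded_base by (auto simp: bounded_iff)
  have "norm x \<le> r * m" if "m > 0" "\<forall>i<p. a i \<bullet> x \<le> m" for x m
    using r[of "(1 / m) *\<^sub>R x"] that by (simp add: field_simps)
  moreover have "r \<ge> 0"
    using r[of 0] by simp
  ultimately show thesis
    using that by blast
qed

text \<open>Counterexamples with \<open>\<eta>\<close> tending to 0 are bounded and accumulate at a
  point \<open>v\<close> of the base. A constraint not tight at \<open>v\<close> eventually leaves
  the sets \<open>S\<close>, so some \<open>S\<close> lies in the tight set of \<open>v\<close>,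
  against \<open>base_tight_sets_subset\<close>.\<close>

lemma nearly_tight:
  obtains \<eta> where "\<eta> > 0"
    "\<And>x T. \<forall>i<p. a i \<bullet> x \<le> 1 + \<eta> \<Longrightarrow> T \<subseteq> {i. i < p \<and> a i \<bullet> x \<ge> 1 - \<eta>} \<Longrightarrow> T \<in> base_tight_sets"
proof -
  define bad where "bad \<eta> x T \<longleftrightarrow> (\<forall>i<p. a i \<bullet> x \<le> 1 + \<eta>)
      \<and> T \<subseteq> {i. i < p \<and> a i \<bullet> x \<ge> 1 - \<eta>} \<and> T \<notin> base_tight_sets" for \<eta> x T
  have "\<exists>\<eta>>0. \<forall>x T. \<not> bad \<eta> x T"
  proof (rule ccontr)
    assume "\<not> ?thesis"
    then have "\<exists>x T. bad (inverse (real (Suc n))) x T" for n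
      using positive_imp_inverse_positive[OF of_nat_0_less_iff[THEN iffD2, OF zero_less_Suc]] by blast
    then obtain X S where bad: "\<And>n. bad (inverse (real (Suc n))) (X n) (S n)"
      by metis
    have X: "a i \<bullet> X n \<le> 1 + inverse (real (Suc n))" if "i < p" for n i
      using bad[of n] that unfolding bad_def by blast
    have S: "S n \<subseteq> {i. i < p \<and> a i \<bullet> X n \<ge> 1 - inverse (real (Suc n))}"
        "S n \<notin> base_tight_sets" for n
      using bad[of n] unfolding bad_def by blast+
    obtain r where r: "\<And>x m. m > 0 \<Longrightarrow> \<forall>i<p. a i \<bullet> x \<le> m \<Longrightarrow> norm x \<le> r * m"
      using bounded_base_radius by blast
    have "norm (X n) \<le> r * 2" for n
    proof (rule r)
      have "inverse (real (Suc n)) \<le> 1"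
        by (simp add: field_simps)
      then have "a i \<bullet> X n \<le> 2" if "i < p" for i
        using X[OF that, of n] by linarith
      then show "\<forall>i<p. a i \<bullet> X n \<le> 2"
        by blast
    qed simp
    then have "bounded (range X)"
      by (auto simp: bounded_iff)
    then obtain v \<sigma> where \<sigma>: "strict_mono \<sigma>" and lim: "(X \<circ> \<sigma>) \<longlonglongrightarrow> v"
      using bounded_imp_convergent_subsequence by blast
    have lim_inv: "(\<lambda>n. inverse (real (Suc (\<sigma> n)))) \<longlonglongrightarrow> 0"
      using LIMSEQ_subseq_LIMSEQ[OF LIMSEQ_inverse_real_of_nat \<sigma>] by (simp add: o_def)
    have lim_a: "(\<lambda>n. a i \<bullet> X (\<sigma> n)) \<longlonglongrightarrow> a i \<bullet> v" for i
      using tendsto_inner[OF tendsto_const lim, of "a i"] by (simp add: o_def)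
    have v: "a i \<bullet> v \<le> 1" if "i < p" for i
      using LIMSEQ_le[OF lim_a tendsto_add[OF tendsto_const lim_inv, of 1]] X[OF that]
      by auto
    have "\<forall>\<^sub>F n in sequentially. \<forall>i\<in>{..<p} - base_tight v. i \<notin> S (\<sigma> n)"
    proof (rule eventually_ball_finite, simp, intro ballI)
      fix i assume i: "i \<in> {..<p} - base_tight v"
      then have "a i \<bullet> v + 0 < 1"
        using v by (force simp: base_tight_def)
      from order_tendstoD(2)[OF tendsto_add[OF lim_a lim_inv] this]
      show "\<forall>\<^sub>F n in sequentially. i \<notin> S (\<sigma> n)"
        by eventually_elim (use S(1) in force)
    qed
    then obtain n where n: "\<forall>i\<in>{..<p} - base_tight v. i \<notin> S (\<sigma> n)"
      by (auto simp: eventually_sequentially)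
    then have "S (\<sigma> n) \<subseteq> base_tight v"
      using S(1)[of "\<sigma> n"] by blast
    moreover have "base_tight v \<in> base_tight_sets"
      using v by (auto simp: base_tight_sets_def)
    ultimately have "S (\<sigma> n) \<in> base_tight_sets"
      using base_tight_sets_subset by blast
    then show False
      using S(2) by blast
  qed
  then show thesis
    using that unfolding bad_def by blast
qed

lemma lower_sum_bound:
  fixes e Y :: real
  assumes "lower_small l e" "i < p" "\<And>k. k < i \<Longrightarrow> \<bar>y k\<bar> \<le> Y" "e \<ge> 0" "Y \<ge> 0"
  shows "\<bar>\<Sum>k<i. l i k * y k\<bar> \<le> p * e * Y"
proof -
  have "\<bar>\<Sum>k<i. l i k * y k\<bar> \<le> (\<Sum>k<i. \<bar>l i k * y k\<bar>)"
    by (rule sum_abs)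
  also have "\<dots> \<le> (\<Sum>k<i. e * Y)"
    using assms by (intro sum_mono) (auto simp: abs_mult lower_small_def intro!: mult_mono)
  also have "\<dots> = i * (e * Y)"
    by simp
  also have "\<dots> \<le> p * (e * Y)"
    using assms by (intro mult_right_mono) auto
  finally show ?thesis
    by (simp add: mult.assoc)
qed

definition form_bound :: real where
  "form_bound = (\<Sum>i<p. norm (a i))"

lemma form_bound_nonneg: "form_bound \<ge> 0"
  by (auto simp: form_bound_def intro: sum_nonneg)

lemma inner_form_bound: "i < p \<Longrightarrow> \<bar>a i \<bullet> x\<bar> \<le> form_bound * norm x"
proof -
  assume "i < p"
  then have "norm (a i) \<le> form_bound"
    unfolding form_bound_def by (intro member_le_sum) auto
  then show ?thesis
    using Cauchy_Schwarz_ineq2[of "a i" x] by (meson mult_right_mono norm_ge_zero order_trans)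
qed

text \<open>The maximum \<open>Y\<close> of the absolute values of the \<open>y i\<close> bounds the
  slacks, and the slacks bound \<open>Y\<close>. For small \<open>e\<close> the part of the
  resulting bound proportional to \<open>Y\<close> can be absorbed, so \<open>M\<close> does not
  depend on \<open>l\<close>.\<close>

lemma feasible_bound:
  obtains M where "M \<ge> 0"
    "\<forall>\<^sub>F e in at_right 0. \<forall>l z. lower_small l e \<longrightarrow> z \<in> feasible (perturbed_form a b l) constraints
       \<longrightarrow> norm (fst z) \<le> M \<and> (\<forall>i<p. \<bar>snd z i\<bar> \<le> M)"
proof -
  obtain r where r: "r \<ge> 0" "\<And>x m. m > 0 \<Longrightarrow> \<forall>i<p. a i \<bullet> x \<le> m \<Longrightarrow> norm x \<le> r * m"
    using bounded_base_radius by blast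
  define \<beta> where "\<beta> = min \<bar>b 0\<bar> \<bar>b 1\<bar>"
  have \<beta>: "\<beta> > 0"
    using opposite_signs by (auto simp: \<beta>_def mult_less_0_iff)
  define K where "K = 1 + form_bound * r"
  have K: "K \<ge> 1"
    using r form_bound_nonneg by (simp add: K_def)
  \<comment> \<open>The term \<open>2 * K / \<beta>\<close> will bound the \<open>y i\<close>, the
    other summand the norm of \<open>x\<close>.\<close>
  define M where "M = r * (1 + 2 * K / \<beta>) + 2 * K / \<beta>"
  have M: "2 * K / \<beta> \<le> M" "M \<ge> 0" "r * (1 + 2 * K / \<beta>) \<le> M"
    using \<beta> K r by (auto simp: M_def)
  have "\<forall>\<^sub>F e in at_right (0::real). p * e * K \<le> \<beta> / 2 \<and> p * e \<le> 1 \<and> e > 0"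
    using eventually_at_right_mult_less[of "\<beta> / 2" "p * K", OF half_gt_zero[OF \<beta>]]
      eventually_at_right_mult_less[of 1 p, OF zero_less_one] eventually_at_right_less[of "0::real"]
    by eventually_elim (auto simp: mult_ac)
  then have "\<forall>\<^sub>F e in at_right 0. \<forall>l z. lower_small l e \<longrightarrow> z \<in> feasible (perturbed_form a b l) constraints
       \<longrightarrow> norm (fst z) \<le> M \<and> (\<forall>i<p. \<bar>snd z i\<bar> \<le> M)"
  proof (eventually_elim, intro allI impI)
    fix e :: real and l :: "nat \<Rightarrow> nat \<Rightarrow> real" and z :: "'a \<times> (nat \<Rightarrow> real)"
    assume e: "p * e * K \<le> \<beta> / 2 \<and> p * e \<le> 1 \<and> e > 0" and l: "lower_small l e"
      and z: "z \<in> feasible (perturbed_form a b l) constraints"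
    define Y where "Y = Max (insert 0 ((\<lambda>i. \<bar>snd z i\<bar>) ` {..<p}))"
    have Y: "\<bar>snd z i\<bar> \<le> Y" if "i < p" for i
      using that by (auto simp: Y_def)
    have Y0: "Y \<ge> 0"
      by (auto simp: Y_def)
    have L: "\<bar>\<Sum>k<i. l i k * snd z k\<bar> \<le> p * e * Y" if "i < p" for i
      using that Y Y0 e l by (intro lower_sum_bound) auto
    have x: "norm (fst z) \<le> r * (1 + p * e * Y)"
    proof (rule r(2))
      show "0 < 1 + real p * e * Y"
        using e Y0 by (intro add_pos_nonneg) auto
      show "\<forall>i<p. a i \<bullet> fst z \<le> 1 + p * e * Y"
        using slack_nonneg[OF z] L by (force simp: slack_def)
    qed
    have "\<beta> * \<bar>snd z i\<bar> \<le> K * (1 + p * e * Y)" if i: "i < p" for i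
    proof -
      have le: "b 0 * snd z i \<le> slack a l z i" "b 1 * snd z i \<le> slack a l z i"
        using z i by (auto simp: mem_feasible_iff)
      \<comment> \<open>Whatever the sign of \<open>snd z i\<close>, one of \<open>b 0\<close> and
        \<open>b 1\<close> makes its product with it nonnegative, and that constraint bounds the
        absolute value.\<close>
      have "\<bar>b 0\<bar> * \<bar>snd z i\<bar> \<le> slack a l z i \<or> \<bar>b 1\<bar> * \<bar>snd z i\<bar> \<le> slack a l z i"
        using le opposite_signs unfolding abs_mult[symmetric] by (auto simp: abs_if mult_less_0_iff zero_less_mult_iff)
      moreover have "\<beta> * \<bar>snd z i\<bar> \<le> \<bar>b 0\<bar> * \<bar>snd z i\<bar>" "\<beta> * \<bar>snd z i\<bar> \<le> \<bar>b 1\<bar> * \<bar>snd z i\<bar>"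
        by (auto simp: \<beta>_def intro!: mult_right_mono)
      ultimately have "\<beta> * \<bar>snd z i\<bar> \<le> slack a l z i"
        by linarith
      also have "\<dots> \<le> 1 + form_bound * norm (fst z) + p * e * Y"
        using inner_form_bound[OF i, of "fst z"] L[OF i] by (simp add: slack_def)
      also have "\<dots> \<le> 1 + form_bound * (r * (1 + p * e * Y)) + p * e * Y"
        using x form_bound_nonneg by (simp add: mult_left_mono)
      also have "\<dots> = K * (1 + p * e * Y)"
        by (simp add: K_def algebra_simps)
      finally show ?thesis .
    qed
    moreover have "Y \<in> insert 0 ((\<lambda>i. \<bar>snd z i\<bar>) ` {..<p})"
      unfolding Y_def by (intro Max_in) auto
    moreover have "K * (1 + p * e * Y) \<ge> 0"
      using K e Y0 by auto
    ultimately have "\<beta> * Y \<le> K * (1 + p * e * Y)"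
      by auto
    also have "\<dots> = K + (p * e * K) * Y"
      by (simp add: algebra_simps)
    also have "\<dots> \<le> K + \<beta> / 2 * Y"
      using e Y0 by (intro add_left_mono mult_right_mono) auto
    finally have YK: "Y \<le> 2 * K / \<beta>"
      using \<beta> by (simp add: field_simps)
    have "p * e * Y \<le> 1 * Y"
      using e Y0 by (intro mult_right_mono) auto
    then have "r * (1 + p * e * Y) \<le> r * (1 + 2 * K / \<beta>)"
      using YK r by (intro mult_left_mono) auto
    then show "norm (fst z) \<le> M \<and> (\<forall>i<p. \<bar>snd z i\<bar> \<le> M)"
      using x M Y YK by force
  qed
  then show thesis
    using that M by blast
qed

text \<open>The perturbing sums stay below the \<open>\<eta>\<close> of \<open>nearly_tight\<close>,
  so a vanishing slack means a nearly tight base constraint.\<close>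

lemma eventually_slack_zero_base_tight:
  "\<forall>\<^sub>F e in at_right 0. \<forall>l z. lower_small l e \<longrightarrow> z \<in> feasible (perturbed_form a b l) constraints
     \<longrightarrow> {i. i < p \<and> slack a l z i = 0} \<in> base_tight_sets"
proof -
  obtain \<eta> where \<eta>: "\<eta> > 0" "\<And>x T. \<forall>i<p. a i \<bullet> x \<le> 1 + \<eta> \<Longrightarrow>
      T \<subseteq> {i. i < p \<and> a i \<bullet> x \<ge> 1 - \<eta>} \<Longrightarrow> T \<in> base_tight_sets"
    using nearly_tight by blast
  obtain M where M: "M \<ge> 0" "\<forall>\<^sub>F e in at_right 0. \<forall>l z. lower_small l e \<longrightarrow>
      z \<in> feasible (perturbed_form a b l) constraints \<longrightarrow> norm (fst z) \<le> M \<and> (\<forall>i<p. \<bar>snd z i\<bar> \<le> M)"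
    using feasible_bound by blast
  show ?thesis
    using M(2) eventually_at_right_mult_less[OF \<eta>(1), of "p * M"] eventually_at_right_less[of "0::real"]
  proof (eventually_elim, intro allI impI)
    fix e :: real and l :: "nat \<Rightarrow> nat \<Rightarrow> real" and z :: "'a \<times> (nat \<Rightarrow> real)"
    assume bd: "\<forall>l z. lower_small l e \<longrightarrow>
      z \<in> feasible (perturbed_form a b l) constraints \<longrightarrow> norm (fst z) \<le> M \<and> (\<forall>i<p. \<bar>snd z i\<bar> \<le> M)"
      and e: "p * M * e < \<eta>" "0 < e" and l: "lower_small l e"
      and z: "z \<in> feasible (perturbed_form a b l) constraints"
    have L: "\<bar>\<Sum>k<i. l i k * snd z k\<bar> \<le> \<eta>" if "i < p" for i
      using lower_sum_bound[OF l that, of "snd z" M] bd l z that e M(1) by (auto simp: mult_ac)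
    have "a i \<bullet> fst z \<le> 1 + \<eta>" if "i < p" for i
      using slack_nonneg[OF z that] L[OF that] by (simp add: slack_def)
    moreover have "a i \<bullet> fst z \<ge> 1 - \<eta>" if "i < p" "slack a l z i = 0" for i
      using that(2) L[OF that(1)] by (simp add: slack_def)
    ultimately show "{i. i < p \<and> slack a l z i = 0} \<in> base_tight_sets"
      by (intro \<eta>(2)[of "fst z"]) auto
  qed
qed

section \<open>Perturbed points with prescribed tight sets\<close>

lemma fibre_point_bound:
  fixes e B :: real
  assumes l: "lower_small l e" and e: "e \<ge> 0" "2 * (p * B) * e \<le> 1"
    and \<tau>: "\<And>i. i < p \<Longrightarrow> \<bar>\<tau> i\<bar> \<le> B" and x: "norm x \<le> \<rho>" and "i < p"
  shows "\<bar>fibre_point a l \<tau> x i\<bar> \<le> 2 * B * (1 + form_bound * \<rho>)"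
  using \<open>i < p\<close>
proof (induction i rule: less_induct)
  case (less i)
  define K where "K = 1 + form_bound * \<rho>"
  have B: "B \<ge> 0"
    using \<tau>[OF less.prems] by linarith
  have K: "K \<ge> 0"
    using form_bound_nonneg order_trans[OF norm_ge_zero x] by (simp add: K_def)
  \<comment> \<open>Earlier entries are bounded by \<open>2 * B * K\<close>, and smallness of
    \<open>e\<close> turns their weighted sum into at most \<open>K\<close>. The slack is then at
    most \<open>2 * K\<close>, which reproduces the bound for entry \<open>i\<close>.\<close>
  have "\<bar>\<Sum>k<i. l i k * fibre_point a l \<tau> x k\<bar> \<le> p * e * (2 * B * K)"
    using less B K e(1) by (intro lower_sum_bound[OF l less.prems]) (auto simp: K_def)
  also have "\<dots> = (2 * (p * B) * e) * K"
    by (simp add: mult_ac)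
  also have "\<dots> \<le> 1 * K"
    using e(2) K by (intro mult_right_mono) auto
  finally have "\<bar>\<Sum>k<i. l i k * fibre_point a l \<tau> x k\<bar> \<le> K"
    by simp
  moreover have "\<bar>a i \<bullet> x\<bar> \<le> form_bound * \<rho>"
    using inner_form_bound[OF less.prems, of x] x form_bound_nonneg
    by (meson mult_left_mono order_trans)
  ultimately have "\<bar>slack a l (x, fibre_point a l \<tau> x) i\<bar> \<le> 2 * K"
    by (simp add: slack_def K_def)
  then have "\<bar>\<tau> i\<bar> * \<bar>slack a l (x, fibre_point a l \<tau> x) i\<bar> \<le> B * (2 * K)"
    using \<tau>[OF less.prems] B by (intro mult_mono) auto
  then show ?case
    by (simp add: fibre_point_slack[of a l \<tau> x i] abs_mult K_def mult_ac)
qed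

text \<open>With the ratios \<open>\<tau>\<^sub>i = y\<^sub>i / slack\<^sub>i\<close> prescribed, \<open>y\<close> is a function of \<open>x\<close>, and making the
  slacks in \<open>T\<close> vanish is a fixed point problem for \<open>x\<close> near a point \<open>w\<close> of the base with tight
  set \<open>T\<close>.\<close>

lemma eventually_perturbed_point:
  assumes T: "T \<in> base_tight_sets"
  shows "\<forall>\<^sub>F e in at_right 0. \<forall>l \<tau>. lower_small l e \<longrightarrow> (\<forall>i<p. \<bar>\<tau> i\<bar> \<le> B) \<longrightarrow>
    (\<exists>z. \<forall>i<p. snd z i = \<tau> i * slack a l z i \<and> slack a l z i \<ge> 0 \<and> (slack a l z i = 0 \<longleftrightarrow> i \<in> T))"
proof -
  obtain w where w: "\<forall>i<p. a i \<bullet> w \<le> 1" and Tw: "T = {i. i < p \<and> a i \<bullet> w = 1}"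
    using T by (auto simp: base_tight_sets_def base_tight_def)
  obtain u where u: "\<And>i j. i \<in> T \<Longrightarrow> j \<in> T \<Longrightarrow> a i \<bullet> u j = (if i = j then 1 else 0)"
    using simple_base[OF w] Tw by auto
  have "finite T"
    by (simp add: Tw)
  define U where "U = (\<Sum>j\<in>T. norm (u j))"
  have U: "U \<ge> 0"
    by (auto simp: U_def intro: sum_nonneg)
  \<comment> \<open>Bounds the fibre coordinates for all \<open>x\<close> in the unit ball around
    \<open>w\<close>.\<close>
  define Y where "Y = 2 * \<bar>B\<bar> * (1 + form_bound * (norm w + 1))"
  have Y: "Y \<ge> 0"
    using form_bound_nonneg by (auto simp: Y_def)
  \<comment> \<open>A shift of \<open>x\<close> by at most \<open>U * (p * Y) * e\<close> and a
    perturbing sum of at most \<open>p * Y * e\<close> must not use up the slack left by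
    \<open>w\<close> outside \<open>T\<close>.\<close>
  have "\<forall>\<^sub>F e in at_right 0. \<forall>i\<in>{..<p} - T. (form_bound * U + 1) * (p * Y) * e < 1 - a i \<bullet> w"
    using w Tw by (intro eventually_ball_finite ballI eventually_at_right_mult_less) force+
  then show ?thesis
    using eventually_at_right_less[of "0::real"]
      eventually_at_right_mult_less[of 1 "2 * (p * \<bar>B\<bar>)", OF zero_less_one]
      eventually_at_right_mult_less[of 1 "U * (p * Y)", OF zero_less_one]
  proof (eventually_elim, intro allI impI)
    fix e :: real and l :: "nat \<Rightarrow> nat \<Rightarrow> real" and \<tau> :: "nat \<Rightarrow> real"
    assume e: "0 < e" "2 * (p * \<bar>B\<bar>) * e < 1" "U * (p * Y) * e < 1"
      and slack_w: "\<forall>i\<in>{..<p} - T. (form_bound * U + 1) * (p * Y) * e < 1 - a i \<bullet> w"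
      and l: "lower_small l e" and \<tau>: "\<forall>i<p. \<bar>\<tau> i\<bar> \<le> B"
    define L where "L i x = (\<Sum>k<i. l i k * fibre_point a l \<tau> x k)" for i x
    \<comment> \<open>As \<open>a i \<bullet> w = 1\<close> and the \<open>u j\<close> are dual to
      the \<open>a i\<close> on \<open>T\<close>, a fixed point \<open>x\<close> satisfies
      \<open>a i \<bullet> x = 1 - L i x\<close> for \<open>i\<close> in \<open>T\<close>: these
      slacks vanish.\<close>
    define \<Phi> where "\<Phi> x = w - (\<Sum>j\<in>T. L j x *\<^sub>R u j)" for x
    have L: "\<bar>L i x\<bar> \<le> p * Y * e" if i: "i < p" and x: "x \<in> cball w 1" for i x
    proof -
      have "norm x \<le> norm w + 1"
        using x norm_triangle_ineq2[of x w] by (simp add: dist_norm norm_minus_commute)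
      then have "\<bar>fibre_point a l \<tau> x k\<bar> \<le> Y" if "k < p" for k
        using fibre_point_bound[OF l _ _ _ _ that, of "\<bar>B\<bar>" \<tau> x "norm w + 1"] e \<tau>
        by (force simp: Y_def)
      then show ?thesis
        using lower_sum_bound[OF l i, of "fibre_point a l \<tau> x" Y] e Y i
        by (simp add: L_def mult_ac)
    qed
    have dist: "norm (\<Phi> x - w) \<le> U * (p * Y) * e" if "x \<in> cball w 1" for x
    proof -
      have "norm (\<Phi> x - w) = norm (\<Sum>j\<in>T. L j x *\<^sub>R u j)"
        by (simp add: \<Phi>_def)
      also have "\<dots> \<le> (\<Sum>j\<in>T. norm (L j x *\<^sub>R u j))"
        by (rule norm_sum)
      also have "\<dots> \<le> (\<Sum>j\<in>T. (p * Y * e) * norm (u j))"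
        using L that Tw by (intro sum_mono) (auto intro: mult_right_mono)
      also have "\<dots> = U * (p * Y) * e"
        by (simp add: U_def sum_distrib_left[symmetric] mult_ac)
      finally show ?thesis .
    qed
    have "\<Phi> \<in> cball w 1 \<rightarrow> cball w 1"
      using dist e(3) by (force simp: dist_norm norm_minus_commute)
    moreover have "continuous_on (cball w 1) \<Phi>"
      unfolding \<Phi>_def L_def by (intro continuous_intros continuous_on_fibre_point)
    ultimately obtain x where x: "x \<in> cball w 1" "\<Phi> x = x"
      using brouwer[of "cball w 1" \<Phi>] by auto
    define z where "z = (x, fibre_point a l \<tau> x)"
    have slack: "slack a l z i = 1 - a i \<bullet> x - L i x" for i
      by (simp add: slack_def z_def L_def)
    have zero: "slack a l z i = 0" if "i \<in> T" for i
    proof -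
      have "a i \<bullet> \<Phi> x = a i \<bullet> w - (\<Sum>j\<in>T. L j x * (a i \<bullet> u j))"
        by (simp add: \<Phi>_def inner_diff_right inner_sum_right)
      also have "(\<Sum>j\<in>T. L j x * (a i \<bullet> u j)) = (\<Sum>j\<in>T. if i = j then L j x else 0)"
        using u that by (intro sum.cong) auto
      finally show ?thesis
        using that \<open>finite T\<close> x(2) Tw by (simp add: slack)
    qed
    have pos: "slack a l z i > 0" if i: "i < p" "i \<notin> T" for i
    proof -
      have "a i \<bullet> x - a i \<bullet> w \<le> form_bound * norm (x - w)"
        using inner_form_bound[OF i(1), of "x - w"] by (simp add: inner_diff_right)
      also have "\<dots> \<le> form_bound * (U * (p * Y) * e)"
        using dist[OF x(1)] x(2) form_bound_nonneg by (intro mult_left_mono) auto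
      finally have "a i \<bullet> x - a i \<bullet> w \<le> form_bound * U * (p * Y) * e"
        by (simp add: mult_ac)
      moreover have "L i x \<le> p * Y * e"
        using L[OF i(1) x(1)] by simp
      moreover have "(form_bound * U + 1) * (p * Y) * e < 1 - a i \<bullet> w"
        using slack_w i by auto
      ultimately show ?thesis
        by (simp add: slack distrib_right)
    qed
    have "snd z i = \<tau> i * slack a l z i" for i
      using fibre_point_slack[of a l \<tau> x i] by (simp add: z_def)
    moreover have "slack a l z i \<ge> 0 \<and> (slack a l z i = 0 \<longleftrightarrow> i \<in> T)" if "i < p" for i
      using zero[of i] pos[OF that] by fastforce
    ultimately show "\<exists>z. \<forall>i<p. snd z i = \<tau> i * slack a l z i \<and> slack a l z i \<ge> 0
        \<and> (slack a l z i = 0 \<longleftrightarrow> i \<in> T)"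
      by blast
  qed
qed

text \<open>The zero perturbation is itself small, so one inclusion between two arbitrary small
  perturbations suffices. A feasible point for \<open>l\<close> provides a base tight set, namely
  its vanishing slacks, and bounded ratios; \<open>eventually_perturbed_point\<close> realizes these
  data for \<open>l'\<close>.\<close>

theorem eventually_tight_sets_eq:
  "\<forall>\<^sub>F e in at_right 0. \<forall>l. lower_small l e \<longrightarrow>
     tight (perturbed_form a b l) constraints ` feasible (perturbed_form a b l) constraints
   = tight (perturbed_form a b (\<lambda>_ _. 0)) constraints ` feasible (perturbed_form a b (\<lambda>_ _. 0)) constraints"
proof -
  define B where "B = 1 / \<bar>b 0\<bar> + 1 / \<bar>b 1\<bar>"
  have \<tau>_le: "\<bar>fibre_coeff b h y\<bar> \<le> B" for h y
    by (simp add: fibre_coeff_def B_def)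
  \<comment> \<open>There are only finitely many base tight sets, so one bound on \<open>e\<close>
    serves them all.\<close>
  have "\<forall>\<^sub>F e in at_right 0. \<forall>T\<in>base_tight_sets. \<forall>l \<tau>. lower_small l e \<longrightarrow> (\<forall>i<p. \<bar>\<tau> i\<bar> \<le> B) \<longrightarrow>
    (\<exists>z. \<forall>i<p. snd z i = \<tau> i * slack a l z i \<and> slack a l z i \<ge> 0 \<and> (slack a l z i = 0 \<longleftrightarrow> i \<in> T))"
    using eventually_perturbed_point finite_base_tight_sets by (intro eventually_ball_finite) auto
  then show ?thesis
    using eventually_slack_zero_base_tight eventually_at_right_less[of "0::real"]
  proof (eventually_elim, intro allI impI)
    fix e :: real and l :: "nat \<Rightarrow> nat \<Rightarrow> real"
    assume pt: "\<forall>T\<in>base_tight_sets. \<forall>l \<tau>. lower_small l e \<longrightarrow> (\<forall>i<p. \<bar>\<tau> i\<bar> \<le> B) \<longrightarrow>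
        (\<exists>z. \<forall>i<p. snd z i = \<tau> i * slack a l z i \<and> slack a l z i \<ge> 0 \<and> (slack a l z i = 0 \<longleftrightarrow> i \<in> T))"
      and zero: "\<forall>l z. lower_small l e \<longrightarrow> z \<in> feasible (perturbed_form a b l) constraints
        \<longrightarrow> {i. i < p \<and> slack a l z i = 0} \<in> base_tight_sets"
      and e: "0 < e" and l: "lower_small l e"
    have sub: "tight (perturbed_form a b l) constraints ` feasible (perturbed_form a b l) constraints
        \<subseteq> tight (perturbed_form a b l') constraints ` feasible (perturbed_form a b l') constraints"
      if l: "lower_small l e" and l': "lower_small l' e" for l l'
    proof
      fix S assume "S \<in> tight (perturbed_form a b l) constraints ` feasible (perturbed_form a b l) constraints"
      then obtain z where z: "z \<in> feasible (perturbed_form a b l) constraints"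
        and S: "S = tight (perturbed_form a b l) constraints z"
        by blast
      define \<tau> where "\<tau> i = fibre_coeff b (slack a l z i) (snd z i)" for i
      have T: "{i. i < p \<and> slack a l z i = 0} \<in> base_tight_sets"
        using zero l z by blast
      have \<tau>: "\<forall>i<p. \<bar>\<tau> i\<bar> \<le> B"
        by (simp add: \<tau>_def \<tau>_le)
      from pt[THEN bspec, OF T, THEN spec, THEN spec, THEN mp, OF l', THEN mp, OF \<tau>]
      obtain z' where z': "\<forall>i<p. snd z' i = \<tau> i * slack a l' z' i
          \<and> slack a l' z' i \<ge> 0 \<and> (slack a l' z' i = 0 \<longleftrightarrow> i \<in> {i. i < p \<and> slack a l z i = 0})"
        by blast
      then have "z' \<in> feasible (perturbed_form a b l') constraints
          \<and> tight (perturbed_form a b l') constraints z' = tight (perturbed_form a b l) constraints z"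
        by (intro conjI tight_eq_fibre_coeff[OF z]) (simp_all add: \<tau>_def)
      then have "z' \<in> feasible (perturbed_form a b l') constraints"
        "S = tight (perturbed_form a b l') constraints z'"
        using S by simp_all
      then show "S \<in> tight (perturbed_form a b l') constraints ` feasible (perturbed_form a b l') constraints"
        by blast
    qed
    have "lower_small (\<lambda>_ _. 0) e"
      using e by (simp add: lower_small_def)
    then show "tight (perturbed_form a b l) constraints ` feasible (perturbed_form a b l) constraints
      = tight (perturbed_form a b (\<lambda>_ _. 0)) constraints ` feasible (perturbed_form a b (\<lambda>_ _. 0)) constraints"
      using sub l by blast
  qed
qed

end

section \<open>Polygons are simple\<close>

text \<open>Distinct facets have equal dimension, so neither contains the other.\<close>

lemma facet_presentation_separate:
  assumes P: "facet_presentation m c P" and ij: "i < m" "j < m" "i \<noteq> j"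
  obtains w where "w \<in> P" "c j \<bullet> w = 1" "c i \<bullet> w < 1"
proof -
  define F where "F i = {x \<in> P. c i \<bullet> x = 1}" for i
  have PX: "P = {x. \<forall>i<m. c i \<bullet> x \<le> 1}" and inj: "inj_on F {..<m}"
    and facet: "\<And>i. i < m \<Longrightarrow> F i facet_of P"
    using P unfolding facet_presentation_def F_def by blast+
  have "\<not> F j \<subseteq> F i"
  proof
    assume sub: "F j \<subseteq> F i"
    have "F j face_of P" "F i face_of P" and dim: "aff_dim (F j) = aff_dim (F i)"
      using facet ij by (auto simp: facet_of_def)
    then have "F j face_of F i" "convex (F i)"
      using sub face_of_subset[of "F j" P "F i"] face_of_imp_subset[of "F i" P]
        face_of_imp_convex[of "F i" P] by simp_all
    then have "F j = F i"
      using face_of_aff_dim_lt[of "F i" "F j"] dim by force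
    then show False
      using inj ij by (auto dest: inj_onD)
  qed
  then obtain w where "w \<in> P" "c j \<bullet> w = 1" "c i \<bullet> w \<noteq> 1"
    by (auto simp: F_def)
  then show thesis
    using that ij PX by force
qed

text \<open>Along each of the three edges there is a direction that decreases the other two forms.
  Three normals in the plane satisfy a linear relation; evaluated on these directions it makes any
  two coefficients either both zero or of opposite signs, so all three vanish.\<close>

lemma no_three_tight_plane:
  fixes c :: "nat \<Rightarrow> real ^ 2"
  assumes P: "facet_presentation m c P" and v: "v \<in> P"
    and ijk: "i < m" "j < m" "k < m" "i \<noteq> j" "i \<noteq> k" "j \<noteq> k"
    and one: "c i \<bullet> v = 1" "c j \<bullet> v = 1" "c k \<bullet> v = 1"
  shows False
proof -
  have PX: "P = {x. \<forall>i<m. c i \<bullet> x \<le> 1}"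
    using P by (simp add: facet_presentation_def)
  have dir: "\<exists>d. c k \<bullet> d = 0 \<and> c i \<bullet> d < 0 \<and> c j \<bullet> d < 0"
    if ijk: "i < m" "j < m" "k < m" "i \<noteq> k" "j \<noteq> k"
      and one: "c i \<bullet> v = 1" "c j \<bullet> v = 1" "c k \<bullet> v = 1" for i j k
  proof -
    obtain w where w: "w \<in> P" "c k \<bullet> w = 1" "c i \<bullet> w < 1"
      using facet_presentation_separate[OF P, of i k] ijk by auto
    obtain w' where w': "w' \<in> P" "c k \<bullet> w' = 1" "c j \<bullet> w' < 1"
      using facet_presentation_separate[OF P, of j k] ijk by auto
    have "c i \<bullet> w' \<le> 1" "c j \<bullet> w \<le> 1"
      using w w' PX ijk by auto
    then show ?thesis
      \<comment> \<open>Both summands stay on facet \<open>k\<close>; \<open>w\<close> makes form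
        \<open>i\<close> decrease, \<open>w'\<close> makes form \<open>j\<close> decrease, and
        neither summand increases the other form.\<close>
      using w w' one by (intro exI[of _ "(w - v) + (w' - v)"], simp only: inner_add_right inner_diff_right) simp
  qed
  obtain di dj dk where
    d: "c i \<bullet> di = 0" "c j \<bullet> di < 0" "c k \<bullet> di < 0"
      "c j \<bullet> dj = 0" "c i \<bullet> dj < 0" "c k \<bullet> dj < 0"
      "c k \<bullet> dk = 0" "c i \<bullet> dk < 0" "c j \<bullet> dk < 0"
    using dir[of j k i] dir[of i k j] dir[of i j k] ijk one by metis
  have distinct: "c i \<noteq> c j" "c i \<noteq> c k" "c j \<noteq> c k"
    using d by auto
  have "dependent {c i, c j, c k}"
    using distinct by (intro dependent_biggerset) auto
  then obtain f where f: "\<exists>x\<in>{c i, c j, c k}. f x \<noteq> 0" "(\<Sum>x\<in>{c i, c j, c k}. f x *\<^sub>R x) = 0"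
    using real_vector.dependent_finite[of "{c i, c j, c k}"] by auto
  define \<alpha> \<beta> \<gamma> where "\<alpha> = f (c i)" and "\<beta> = f (c j)" and "\<gamma> = f (c k)"
  have sum: "\<alpha> *\<^sub>R c i + \<beta> *\<^sub>R c j + \<gamma> *\<^sub>R c k = 0"
    using f(2) distinct by (simp add: \<alpha>_def \<beta>_def \<gamma>_def add.assoc)
  have dot: "\<alpha> * (c i \<bullet> x) + \<beta> * (c j \<bullet> x) + \<gamma> * (c k \<bullet> x) = 0" for x
    using arg_cong[OF sum, of "\<lambda>y. y \<bullet> x"] by (simp add: inner_add_left)
  have opp: "(s > 0 \<and> t < 0) \<or> (s < 0 \<and> t > 0) \<or> (s = 0 \<and> t = 0)"
    if "s * g + t * h = 0" "g < 0" "h < 0" for s t g h :: real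
    using that
    by (smt (verit) mult_neg_neg mult_pos_neg mult_eq_0_iff)
  have "\<beta> * (c j \<bullet> di) + \<gamma> * (c k \<bullet> di) = 0" "\<alpha> * (c i \<bullet> dj) + \<gamma> * (c k \<bullet> dj) = 0"
    "\<alpha> * (c i \<bullet> dk) + \<beta> * (c j \<bullet> dk) = 0"
    using dot[of di] dot[of dj] dot[of dk] d by simp_all
  with opp d have "\<alpha> = 0 \<and> \<beta> = 0 \<and> \<gamma> = 0"
    by (smt (verit))
  then show False
    using f(1) by (auto simp: \<alpha>_def \<beta>_def \<gamma>_def)
qed

text \<open>At most one edge \<open>k\<close> besides \<open>j\<close> passes through
  \<open>v\<close>, and a vector along it, scaled against \<open>c j\<close>, is dual. If there is
  no such \<open>k\<close>, \<open>v\<close> itself is.\<close>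

lemma polygon_simple:
  fixes c :: "nat \<Rightarrow> real ^ 2"
  assumes P: "facet_presentation m c P" and v: "v \<in> P"
  shows "\<exists>u. \<forall>i<m. \<forall>j<m. c i \<bullet> v = 1 \<longrightarrow> c j \<bullet> v = 1 \<longrightarrow> c i \<bullet> u j = (if i = j then 1 else 0)"
proof -
  have "\<exists>x. \<forall>i<m. c i \<bullet> v = 1 \<longrightarrow> c j \<bullet> v = 1 \<longrightarrow> c i \<bullet> x = (if i = j then 1 else 0)" if j: "j < m" for j
  proof (cases "\<exists>k<m. k \<noteq> j \<and> c k \<bullet> v = 1 \<and> c j \<bullet> v = 1")
    case True
    then obtain k where k: "k < m" "k \<noteq> j" "c k \<bullet> v = 1" "c j \<bullet> v = 1" by auto
    obtain w where w: "w \<in> P" "c k \<bullet> w = 1" "c j \<bullet> w < 1"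
      using facet_presentation_separate[OF P, of j k] j k by auto
    define x where "x = (1 / (1 - c j \<bullet> w)) *\<^sub>R (v - w)"
    have "c j \<bullet> x = 1" "c k \<bullet> x = 0"
      using k w by (auto simp: x_def inner_diff_right)
    moreover have "i = j \<or> i = k" if "i < m" "c i \<bullet> v = 1" for i
      using no_three_tight_plane[OF P v, of i j k] that j k by blast
    ultimately show ?thesis
      using k by (intro exI[of _ x]) auto
  qed auto
  then show ?thesis
    by metis
qed

text \<open>Otherwise a whole half-line would satisfy both inequalities.\<close>

lemma interval_presentation_opposite_signs:
  assumes "interval_presentation b"
  shows "b 0 * b 1 < 0"
proof (rule ccontr)
  assume neg: "\<not> b 0 * b 1 < 0"
  have "bounded {y. \<forall>j<2. b j * y \<le> 1}"
    using assms by (simp add: interval_presentation_def facet_presentation_def)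
  then obtain B where B: "\<And>y. b 0 * y \<le> 1 \<Longrightarrow> b 1 * y \<le> 1 \<Longrightarrow> \<bar>y\<bar> \<le> B"
    by (auto simp: bounded_iff less_2_cases_iff)
  have "B \<ge> 0"
    using B[of 0] by simp
  consider "b 0 \<ge> 0" "b 1 \<ge> 0" | "b 0 \<le> 0" "b 1 \<le> 0"
    using neg by (fastforce simp: mult_less_0_iff not_less not_le)
  then show False
  proof cases
    case 1
    then have "b 0 * - (B + 1) \<le> 0" "b 1 * - (B + 1) \<le> 0"
      using \<open>B \<ge> 0\<close> by (intro mult_nonneg_nonpos; simp)+
    then show False
      using B[of "- (B + 1)"] \<open>B \<ge> 0\<close> by simp
  next
    case 2
    then have "b 0 * (B + 1) \<le> 0" "b 1 * (B + 1) \<le> 0"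
      using \<open>B \<ge> 0\<close> by (intro mult_nonpos_nonneg; simp)+
    then show False
      using B[of "B + 1"] \<open>B \<ge> 0\<close> by simp
  qed
qed

lemma cyclic_polygon_wedge_base:
  assumes "cyclic_polygon p a" "interval_presentation b"
  shows "wedge_base p a b"
proof -
  define C where "C = {x. \<forall>i<p. a i \<bullet> x \<le> 1}"
  have C: "facet_presentation p a C"
    using assms(1) by (simp add: cyclic_polygon_def Let_def C_def)
  show ?thesis
  proof
    show "bounded {x. \<forall>i<p. a i \<bullet> x \<le> 1}"
      using C by (simp add: facet_presentation_def C_def)
    show "b 0 * b 1 < 0"
      using assms(2) by (rule interval_presentation_opposite_signs)
  qed (use polygon_simple[OF C] in \<open>simp add: C_def\<close>)
qed

section \<open>Coordinates and the realization\<close>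

lemma coord_exists: "\<exists>v :: real ^ 'n::{finite,linorder}. \<forall>k<CARD('n). coord k v = c k"
proof -
  define L where "L = sorted_list_of_set (UNIV :: 'n set)"
  have L: "distinct L" "length L = CARD('n)"
    by (simp_all add: L_def)
  define v :: "real ^ 'n::{finite,linorder}" where "v = (\<chi> i. c (THE k. k < CARD('n) \<and> L ! k = i))"
  have "coord k v = c k" if k: "k < CARD('n)" for k
  proof -
    have "(THE k'. k' < CARD('n) \<and> L ! k' = L ! k) = k"
      using k L by (intro the_equality) (auto simp: nth_eq_iff_index_eq)
    then show ?thesis
      by (simp add: coord_def v_def L_def)
  qed
  then show ?thesis
    by blast
qed

lemma component_eq_coord:
  fixes i :: "'n::{finite,linorder}"
  obtains k where "k < CARD('n)" "\<And>v. v $ i = coord k v"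
proof -
  have "i \<in> set (sorted_list_of_set (UNIV :: 'n set))"
    by simp
  then obtain k where "k < CARD('n)" "sorted_list_of_set (UNIV :: 'n set) ! k = i"
    by (metis in_set_conv_nth length_sorted_list_of_set)
  then show thesis
    using that by (auto simp: coord_def)
qed

lemma coord_eqI:
  fixes v w :: "real ^ 'n::{finite,linorder}"
  assumes "\<And>k. k < CARD('n) \<Longrightarrow> coord k v = coord k w"
  shows "v = w"
  by (metis assms component_eq_coord vec_eq_iff)

lemma norm_le_coord:
  fixes v :: "real ^ 'n::{finite,linorder}" and M :: real
  assumes "\<And>k. k < CARD('n) \<Longrightarrow> \<bar>coord k v\<bar> \<le> M"
  shows "norm v \<le> CARD('n) * M"
proof -
  have "\<bar>v $ i\<bar> \<le> M" for i
    by (metis assms component_eq_coord)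
  then have "(\<Sum>i\<in>UNIV. \<bar>v $ i\<bar>) \<le> CARD('n) * M"
    using sum_bounded_above[of UNIV "\<lambda>i. \<bar>v $ i\<bar>" M] by simp
  then show ?thesis
    using norm_le_l1_cart[of v] by linarith
qed

lemma coord_add [simp]: "coord k (v + w) = coord k v + coord k w"
  and coord_scaleR [simp]: "coord k (t *\<^sub>R v) = t * coord k v"
  by (simp_all add: coord_def)

lemma vector_4_nth [simp]:
  "(vector [x, y, z, t] :: 'a::zero ^ 4) $ 1 = x"
  "(vector [x, y, z, t] :: 'a::zero ^ 4) $ 2 = y"
  "(vector [x, y, z, t] :: 'a::zero ^ 4) $ 3 = z"
  "(vector [x, y, z, t] :: 'a::zero ^ 4) $ 4 = t"
  by (simp_all add: vector_def)

lemma linear_last4: "linear last4"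
  by (rule linearI) (simp_all add: last4_def vec_eq_iff forall_4)

lemma linear_last3: "linear last3"
  by (rule linearI) (simp_all add: last3_def vec_eq_iff forall_3)

lemma inner_vector_2: "(x :: real ^ 2) \<bullet> vector [s, t] = x $ 1 * s + x $ 2 * t"
  by (simp add: inner_vec_def sum_2)

section \<open>Placement of coordinates in the wedge and in its realization\<close>

definition wedge_point :: "real ^ 'n::{finite,linorder} \<Rightarrow> (real ^ 2) \<times> (nat \<Rightarrow> real)" where
  "wedge_point v = (vector [coord 0 v, coord 1 v], \<lambda>i. coord (2 + i) v)"

text \<open>With \<open>x\<close> placed last, in dimension \<open>2 + p\<close> the map
  \<open>last4\<close> retains \<open>y\<close> at \<open>p - 2\<close> and \<open>p - 1\<close>
  together with \<open>x\<close>, and \<open>last3\<close> retains \<open>y\<close> at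
  \<open>p - 1\<close> and \<open>x\<close>.\<close>

definition deformed_point :: "nat \<Rightarrow> real ^ 'n::{finite,linorder} \<Rightarrow> (real ^ 2) \<times> (nat \<Rightarrow> real)" where
  "deformed_point p v = (vector [coord p v, coord (Suc p) v], \<lambda>i. coord i v)"

lemma linear_perturbed_form_wedge_point: "linear (\<lambda>v. perturbed_form a b l r (wedge_point v))"
  by (rule linearI)
    (simp_all add: perturbed_form_def wedge_point_def inner_vector_2 algebra_simps sum.distrib
      sum_distrib_left)

lemma linear_perturbed_form_deformed_point:
  "linear (\<lambda>v. perturbed_form a b l r (deformed_point p v))"
  by (rule linearI)
    (simp_all add: perturbed_form_def deformed_point_def inner_vector_2 algebra_simps sum.distrib
      sum_distrib_left)

lemma tight_comp: "tight (\<lambda>r v. f r (h v)) R v = tight f R (h v)"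
  by (simp add: tight_def)

lemma feasible_comp: "v \<in> feasible (\<lambda>r v. f r (h v)) R \<longleftrightarrow> h v \<in> feasible f R"
  by (simp add: feasible_def)

text \<open>Surjectivity of \<open>h\<close> is required only as far as the forms can tell: a vector
  cannot prescribe a whole infinite sequence, but it can prescribe the entries that occur.\<close>

lemma tight_image_comp:
  assumes "\<And>z. \<exists>v. \<forall>r\<in>R. f r (h v) = f r z"
  shows "tight (\<lambda>r v. f r (h v)) R ` feasible (\<lambda>r v. f r (h v)) R = tight f R ` feasible f R"
proof
  show "tight f R ` feasible f R \<subseteq> tight (\<lambda>r v. f r (h v)) R ` feasible (\<lambda>r v. f r (h v)) R"
  proof
    fix S assume "S \<in> tight f R ` feasible f R"
    then obtain z where z: "z \<in> feasible f R" "S = tight f R z" by blast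
    obtain v where "\<forall>r\<in>R. f r (h v) = f r z"
      using assms by blast
    then have "h v \<in> feasible f R" "tight f R (h v) = S"
      using z by (auto simp: feasible_def tight_def)
    then show "S \<in> tight (\<lambda>r v. f r (h v)) R ` feasible (\<lambda>r v. f r (h v)) R"
      by (metis feasible_comp image_eqI tight_comp)
  qed
qed (auto simp: tight_comp feasible_comp)

lemma perturbed_form_cong:
  assumes "fst z = fst z'" "\<And>i. i < p \<Longrightarrow> snd z i = snd z' i" "fst r < p"
  shows "perturbed_form a b l r z = perturbed_form a b l r z'"
  using assms by (auto simp: perturbed_form_def)

lemma vector_2_eta: "vector [x $ 1, x $ 2] = (x :: real ^ 2)"
  by (simp add: vec_eq_iff forall_2)

lemma tight_image_wedge_point:
  assumes "CARD('n::{finite,linorder}) = 2 + p"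
  shows "tight (\<lambda>r v. perturbed_form a b l r (wedge_point v)) ({..<p} \<times> J)
       ` feasible (\<lambda>r (v :: real ^ 'n::{finite,linorder}). perturbed_form a b l r (wedge_point v)) ({..<p} \<times> J)
     = tight (perturbed_form a b l) ({..<p} \<times> J) ` feasible (perturbed_form a b l) ({..<p} \<times> J)"
proof (rule tight_image_comp)
  fix z :: "(real ^ 2) \<times> (nat \<Rightarrow> real)"
  obtain v :: "real ^ 'n::{finite,linorder}" where v: "\<forall>k<CARD('n). coord k v =
      (if k = 0 then fst z $ 1 else if k = 1 then fst z $ 2 else snd z (k - 2))"
    using coord_exists[of "\<lambda>k. if k = 0 then fst z $ 1 else if k = 1 then fst z $ 2 else snd z (k - 2)"] by blast
  have "perturbed_form a b l r (wedge_point v) = perturbed_form a b l r z" if "r \<in> {..<p} \<times> J" for r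
    by (rule perturbed_form_cong[where p = p]) (use v that assms in \<open>auto simp: wedge_point_def vector_2_eta\<close>)
  then show "\<exists>v :: real ^ 'n::{finite,linorder}. \<forall>r\<in>{..<p} \<times> J. perturbed_form a b l r (wedge_point v) = perturbed_form a b l r z"
    by blast
qed

lemma tight_image_deformed_point:
  assumes "CARD('n::{finite,linorder}) = 2 + p"
  shows "tight (\<lambda>r v. perturbed_form a b l r (deformed_point p v)) ({..<p} \<times> J)
       ` feasible (\<lambda>r (v :: real ^ 'n::{finite,linorder}). perturbed_form a b l r (deformed_point p v)) ({..<p} \<times> J)
     = tight (perturbed_form a b l) ({..<p} \<times> J) ` feasible (perturbed_form a b l) ({..<p} \<times> J)"
proof (rule tight_image_comp)
  fix z :: "(real ^ 2) \<times> (nat \<Rightarrow> real)"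
  obtain v :: "real ^ 'n::{finite,linorder}" where v: "\<forall>k<CARD('n). coord k v =
      (if k = p then fst z $ 1 else if k = Suc p then fst z $ 2 else snd z k)"
    using coord_exists[of "\<lambda>k. if k = p then fst z $ 1 else if k = Suc p then fst z $ 2 else snd z k"] by blast
  have "perturbed_form a b l r (deformed_point p v) = perturbed_form a b l r z" if "r \<in> {..<p} \<times> J" for r
    by (rule perturbed_form_cong[where p = p]) (use v that assms in \<open>auto simp: deformed_point_def vector_2_eta\<close>)
  then show "\<exists>v :: real ^ 'n::{finite,linorder}. \<forall>r\<in>{..<p} \<times> J. perturbed_form a b l r (deformed_point p v) = perturbed_form a b l r z"
    by blast
qed

lemma polyhedron_feasible:
  fixes f :: "'r \<Rightarrow> 'v::euclidean_space \<Rightarrow> real"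
  assumes "finite R" "\<And>r. r \<in> R \<Longrightarrow> linear (f r)"
  shows "polyhedron (feasible f R)"
proof -
  have "polyhedron {v. f r v \<le> 1}" if "r \<in> R" for r
  proof -
    have "f r v = adjoint (f r) 1 \<bullet> v" for v
      using adjoint_works[OF assms(2)[OF that], of v 1] by (simp add: inner_commute)
    then show ?thesis
      by (simp add: polyhedron_halfspace_le)
  qed
  then have "polyhedron (\<Inter>r\<in>R. {v. f r v \<le> 1})"
    using \<open>finite R\<close> by (intro polyhedron_Inter) auto
  moreover have "(\<Inter>r\<in>R. {v. f r v \<le> 1}) = feasible f R"
    by (auto simp: feasible_def)
  ultimately show ?thesis
    by simp
qed

lemma bounded_deformed:
  fixes M :: real
  assumes card: "CARD('n::{finite,linorder}) = 2 + p"
    and bd: "\<And>z. z \<in> feasible (perturbed_form a b l) R \<Longrightarrow> norm (fst z) \<le> M \<and> (\<forall>i<p. \<bar>snd z i\<bar> \<le> M)"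
  shows "bounded (feasible (\<lambda>r (v :: real ^ 'n::{finite,linorder}). perturbed_form a b l r (deformed_point p v)) R)"
proof -
  have "norm v \<le> CARD('n) * M"
    if "v \<in> feasible (\<lambda>r (v :: real ^ 'n::{finite,linorder}). perturbed_form a b l r (deformed_point p v)) R" for v
  proof (rule norm_le_coord)
    fix k assume k: "k < CARD('n)"
    have "deformed_point p v \<in> feasible (perturbed_form a b l) R"
      using that by (simp add: feasible_comp)
    from bd[OF this] have x: "norm (vector [coord p v, coord (Suc p) v] :: real ^ 2) \<le> M"
      and y: "\<forall>i<p. \<bar>coord i v\<bar> \<le> M"
      by (simp_all add: deformed_point_def)
    have "\<bar>coord p v\<bar> \<le> M" "\<bar>coord (Suc p) v\<bar> \<le> M"
      using component_le_norm_cart[of "vector [coord p v, coord (Suc p) v] :: real ^ 2" 1]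
        component_le_norm_cart[of "vector [coord p v, coord (Suc p) v] :: real ^ 2" 2] x
      by auto
    moreover have "k < p \<or> k = p \<or> k = Suc p"
      using k card by auto
    ultimately show "\<bar>coord k v\<bar> \<le> M"
      using y by auto
  qed
  then show ?thesis
    by (auto simp: bounded_iff)
qed

section \<open>Supporting functionals of the surface polygons\<close>

definition shear :: "nat \<Rightarrow> real \<Rightarrow> (nat \<Rightarrow> real) \<Rightarrow> nat \<Rightarrow> nat \<Rightarrow> real" where
  "shear q e d i k = (if i = Suc q then - d k else if Suc k = i then e else 0)"

text \<open>Row \<open>i\<close> with \<open>1 \<le> i \<le> q\<close> perturbs by \<open>e y\<^sub>i\<^sub>-\<^sub>1\<close> and the last row by \<open>- d\<^sub>0 y\<^sub>0 - \<dots> - d\<^sub>q y\<^sub>q\<close>.  The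
  column sums then vanish iff the weights satisfy a first-order recursion, whose solution stays
  positive whatever the signs of the \<open>\<beta>\<^sub>k\<close> as soon as \<open>d\<close> grows fast enough.\<close>

lemma shear_weighted_sum:
  assumes rec: "\<And>k. k < q \<Longrightarrow> e * \<kappa> (Suc k) = d k - \<beta> k * \<kappa> k" and last: "\<kappa> (Suc q) = 1"
  shows "(\<Sum>i<Suc (Suc q). \<kappa> i * (\<beta> i * y i + (\<Sum>k<i. shear q e d i k * y k)))
       = (\<beta> q * \<kappa> q - d q) * y q + \<beta> (Suc q) * y (Suc q)"
proof -
  define s where "s i = (\<Sum>k<i. shear q e d i k * y k)" for i
  have s_Suc: "s (Suc i) = e * y i" if "i < q" for i
  proof -
    have "s (Suc i) = (\<Sum>k<Suc i. if k = i then e * y k else 0)"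
      unfolding s_def using that by (intro sum.cong) (auto simp: shear_def)
    then show ?thesis
      by simp
  qed
  have s_0: "s 0 = 0"
    by (simp add: s_def)
  have s_last: "s (Suc q) = - (\<Sum>i<q. d i * y i) - d q * y q"
    by (simp add: s_def shear_def sum_negf)
  have "(\<Sum>i<Suc q. \<kappa> i * s i) = (\<Sum>i<q. \<kappa> (Suc i) * s (Suc i))"
    by (subst sum.lessThan_Suc_shift) (simp add: s_0)
  also have "\<dots> = (\<Sum>i<q. (e * \<kappa> (Suc i)) * y i)"
    by (intro sum.cong) (auto simp: s_Suc)
  also have "\<dots> = (\<Sum>i<q. d i * y i) - (\<Sum>i<q. \<kappa> i * (\<beta> i * y i))"
    by (simp add: rec sum_subtractf[symmetric] algebra_simps)
  finally have "(\<Sum>i<Suc q. \<kappa> i * s i) = (\<Sum>i<q. d i * y i) - (\<Sum>i<q. \<kappa> i * (\<beta> i * y i))" .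
  moreover have "(\<Sum>i<Suc (Suc q). \<kappa> i * (\<beta> i * y i + s i))
      = (\<Sum>i<q. \<kappa> i * (\<beta> i * y i)) + \<kappa> q * (\<beta> q * y q) + (\<Sum>i<Suc q. \<kappa> i * s i)
        + (\<beta> (Suc q) * y (Suc q) + s (Suc q))"
    by (simp add: distrib_left sum.distrib last)
  ultimately show ?thesis
    using s_last unfolding s_def[symmetric] by (simp only: mult_ac) (simp add: algebra_simps)
qed

text \<open>The invariant \<open>0 < \<mu> k\<close> and \<open>B * \<mu> k < d k\<close> puts
  \<open>d k - \<beta> k * \<mu> k\<close> strictly between 0 and \<open>2 * d k\<close>; the growth
  of \<open>d\<close> then restores it at the next index. The starting value is half of the allowed
  maximum.\<close>

lemma shear_positive_weights:
  fixes e B :: real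
  assumes "e > 0" "B > 0" and \<beta>: "\<And>i. \<bar>\<beta> i\<bar> \<le> B" and d: "\<And>k. d k > 0"
    and growth: "\<And>k. k < q \<Longrightarrow> 2 * B * d k < e * d (Suc k)"
  obtains \<kappa> where "\<And>i. i < Suc (Suc q) \<Longrightarrow> \<kappa> i > 0" "\<kappa> (Suc q) = 1"
    "\<And>k. k < q \<Longrightarrow> e * \<kappa> (Suc k) = d k - \<beta> k * \<kappa> k" "\<beta> q * \<kappa> q < d q"
proof -
  define \<mu> where "\<mu> = rec_nat (d 0 / (2 * B)) (\<lambda>k m. (d k - \<beta> k * m) / e)"
  have \<mu>_0: "\<mu> 0 = d 0 / (2 * B)" and \<mu>_Suc: "\<mu> (Suc k) = (d k - \<beta> k * \<mu> k) / e" for k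
    by (simp_all add: \<mu>_def)
  have abs_le: "\<bar>\<beta> k * \<mu> k\<bar> \<le> B * \<mu> k" if "\<mu> k > 0" for k
    using \<beta>[of k] that by (simp add: abs_mult mult_right_mono)
  have \<mu>: "0 < \<mu> k \<and> B * \<mu> k < d k" if "k \<le> q" for k
    using that
  proof (induction k)
    case 0
    then show ?case
      using d[of 0] \<open>B > 0\<close> by (simp add: \<mu>_0)
  next
    case (Suc k)
    then have k: "0 < \<mu> k" "B * \<mu> k < d k"
      by auto
    then have less: "0 < d k - \<beta> k * \<mu> k" "d k - \<beta> k * \<mu> k < 2 * d k"
      using abs_le[OF k(1)] by linarith+
    have "B * (d k - \<beta> k * \<mu> k) < B * (2 * d k)"
      using less \<open>B > 0\<close> by (intro mult_strict_left_mono) auto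
    also have "\<dots> < e * d (Suc k)"
      using growth[of k] Suc.prems by simp
    finally show ?case
      using less \<open>e > 0\<close> by (simp add: \<mu>_Suc field_simps)
  qed
  \<comment> \<open>The recursion stops at \<open>q\<close>, since column \<open>q\<close> survives
    the projection and its coefficient only has to be negative; the last weight is free and
    normalized to 1.\<close>
  define \<kappa> where "\<kappa> i = (if i = Suc q then 1 else \<mu> i)" for i
  show thesis
  proof
    show "\<kappa> i > 0" if "i < Suc (Suc q)" for i
      using \<mu>[of i] that by (auto simp: \<kappa>_def)
    show "\<beta> q * \<kappa> q < d q"
      using \<mu>[of q] abs_le[of q] by (auto simp: \<kappa>_def)
    show "e * \<kappa> (Suc k) = d k - \<beta> k * \<kappa> k" if "k < q" for k
      using that \<open>e > 0\<close> by (simp add: \<kappa>_def \<mu>_Suc)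
  qed (simp add: \<kappa>_def)
qed

lemma inner_last4:
  fixes v :: "real ^ 'n::{finite,linorder}"
  assumes "CARD('n) = 4 + q"
  shows "c \<bullet> last4 v = c $ 1 * coord q v + c $ 2 * coord (Suc q) v
    + c $ 3 * coord (Suc (Suc q)) v + c $ 4 * coord (Suc (Suc (Suc q))) v"
proof -
  have "CARD('n) - 4 = q" "CARD('n) - 3 = Suc q" "CARD('n) - 2 = Suc (Suc q)"
    "CARD('n) - 1 = Suc (Suc (Suc q))"
    using assms by auto
  then show ?thesis
    by (simp only: last4_def inner_vec_def sum_4 vector_4_nth inner_real_def)
qed

text \<open>The weights cancel \<open>y k\<close> for \<open>k < q\<close>, so the positive
  combination of the facet forms factors through \<open>last4\<close>; \<open>c $ 1\<close> is the
  remaining coefficient of \<open>y q\<close>.\<close>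

lemma shear_functional_last4:
  fixes a :: "nat \<Rightarrow> real ^ 2" and e B :: real
  assumes card: "CARD('n::{finite,linorder}) = 2 + p" and p: "p = Suc (Suc q)"
    and "e > 0" "B > 0" and b: "\<And>i. \<bar>b (s i)\<bar> \<le> B" and d: "\<And>k. d k > 0"
    and growth: "\<And>k. k < q \<Longrightarrow> 2 * B * d k < e * d (Suc k)"
  obtains \<kappa> c where "\<And>i. i < p \<Longrightarrow> \<kappa> i > 0" "c $ 1 < 0"
    "\<And>v :: real ^ 'n::{finite,linorder}. c \<bullet> last4 v =
      (\<Sum>i<p. \<kappa> i * perturbed_form a b (shear q e d) (i, s i) (deformed_point p v))"
proof -
  obtain \<kappa> where \<kappa>: "\<And>i. i < p \<Longrightarrow> \<kappa> i > 0" "\<kappa> (Suc q) = 1"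
    "\<And>k. k < q \<Longrightarrow> e * \<kappa> (Suc k) = d k - b (s k) * \<kappa> k" "b (s q) * \<kappa> q < d q"
    using shear_positive_weights[of e B "\<lambda>i. b (s i)" d q] assms by blast
  define A where "A = (\<Sum>i<p. \<kappa> i *\<^sub>R a i)"
  define c :: "real ^ 4" where "c = vector [b (s q) * \<kappa> q - d q, b (s (Suc q)), A $ 1, A $ 2]"
  have "c \<bullet> last4 v = (\<Sum>i<p. \<kappa> i * perturbed_form a b (shear q e d) (i, s i) (deformed_point p v))"
    for v :: "real ^ 'n::{finite,linorder}"
  proof -
    define x :: "real ^ 2" where "x = vector [coord p v, coord (Suc p) v]"
    have "(\<Sum>i<p. \<kappa> i * perturbed_form a b (shear q e d) (i, s i) (deformed_point p v))
        = (\<Sum>i<p. \<kappa> i * (a i \<bullet> x))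
          + (\<Sum>i<p. \<kappa> i * (b (s i) * coord i v + (\<Sum>k<i. shear q e d i k * coord k v)))"
      by (simp add: perturbed_form_def deformed_point_def x_def distrib_left sum.distrib add.assoc)
    also have "(\<Sum>i<p. \<kappa> i * (a i \<bullet> x)) = A \<bullet> x"
      by (simp add: A_def inner_sum_left)
    also have "(\<Sum>i<p. \<kappa> i * (b (s i) * coord i v + (\<Sum>k<i. shear q e d i k * coord k v)))
        = (b (s q) * \<kappa> q - d q) * coord q v + b (s (Suc q)) * coord (Suc q) v"
      using shear_weighted_sum[of q e \<kappa> d "\<lambda>i. b (s i)" "\<lambda>k. coord k v", OF \<kappa>(3,2)] p by simp
    finally show ?thesis
      using card p by (simp add: inner_last4[where q = q] c_def x_def inner_vector_2)
  qed
  then show thesis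
    using that[of \<kappa> c] \<kappa> by (simp add: c_def)
qed

text \<open>The two sides differ by a positively weighted sum of the nonnegative numbers
  \<open>1 - g (i, s i) w\<close>.\<close>

lemma positive_combination_face:
  assumes "finite I" and \<kappa>: "\<And>i. i \<in> I \<Longrightarrow> \<kappa> i > (0::real)"
    and R: "(\<lambda>i. (i, s i)) ` I \<subseteq> R" and w: "w \<in> feasible g R"
  shows "(\<Sum>i\<in>I. \<kappa> i * g (i, s i) w) \<le> sum \<kappa> I"
    and "(\<Sum>i\<in>I. \<kappa> i * g (i, s i) w) = sum \<kappa> I \<longleftrightarrow> (\<lambda>i. (i, s i)) ` I \<subseteq> tight g R w"
proof -
  have g: "g (i, s i) w \<le> 1" if "i \<in> I" for i
    using R w that by (auto simp: feasible_def)
  have nonneg: "\<And>i. i \<in> I \<Longrightarrow> 0 \<le> \<kappa> i * (1 - g (i, s i) w)"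
    using g \<kappa> by (simp add: less_imp_le)
  have eq: "(\<Sum>i\<in>I. \<kappa> i * (1 - g (i, s i) w)) = sum \<kappa> I - (\<Sum>i\<in>I. \<kappa> i * g (i, s i) w)"
    by (simp add: right_diff_distrib sum_subtractf)
  show "(\<Sum>i\<in>I. \<kappa> i * g (i, s i) w) \<le> sum \<kappa> I"
    using sum_nonneg[of I "\<lambda>i. \<kappa> i * (1 - g (i, s i) w)"] nonneg eq by force
  have "(\<Sum>i\<in>I. \<kappa> i * g (i, s i) w) = sum \<kappa> I \<longleftrightarrow> (\<Sum>i\<in>I. \<kappa> i * (1 - g (i, s i) w)) = 0"
    using eq by auto
  also have "\<dots> \<longleftrightarrow> (\<forall>i\<in>I. \<kappa> i * (1 - g (i, s i) w) = 0)"
    using sum_nonneg_eq_0_iff[OF \<open>finite I\<close> nonneg] by simp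
  also have "\<dots> \<longleftrightarrow> (\<lambda>i. (i, s i)) ` I \<subseteq> tight g R w"
    using R \<kappa> by (force simp: tight_def)
  finally show "(\<Sum>i\<in>I. \<kappa> i * g (i, s i) w) = sum \<kappa> I \<longleftrightarrow> (\<lambda>i. (i, s i)) ` I \<subseteq> tight g R w" .
qed

text \<open>The equations of a polygon are lower triangular in \<open>y\<close> with diagonal
  entries \<open>b (s i)\<close>, so forward substitution recovers \<open>y\<close> from
  \<open>x\<close>.\<close>

lemma deformed_polygon_determined:
  fixes v w :: "real ^ 'n::{finite,linorder}"
  assumes card: "CARD('n) = 2 + p" and b: "\<And>i. i < p \<Longrightarrow> b (s i) \<noteq> 0"
    and v: "\<And>i. i < p \<Longrightarrow> perturbed_form a b l (i, s i) (deformed_point p v) = 1"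
    and w: "\<And>i. i < p \<Longrightarrow> perturbed_form a b l (i, s i) (deformed_point p w) = 1"
    and eq: "coord p v = coord p w" "coord (Suc p) v = coord (Suc p) w"
  shows "v = w"
proof (rule coord_eqI)
  have *: "coord i v = coord i w" if "i < p" for i
    using that
  proof (induction i rule: less_induct)
    case (less i)
    have "(\<Sum>k<i. l i k * coord k v) = (\<Sum>k<i. l i k * coord k w)"
      using less by (intro sum.cong) auto
    then have "b (s i) * coord i v = b (s i) * coord i w"
      using v[OF less.prems] w[OF less.prems]
      unfolding perturbed_form_def deformed_point_def eq fst_conv snd_conv by linarith
    then show ?case
      using b[OF less.prems] by simp
  qed
  fix k assume "k < CARD('n)"
  then have "k < p \<or> k = p \<or> k = Suc p"
    using card by auto
  then show "coord k v = coord k w"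
    using * eq by auto
qed

section \<open>The surface polygons as faces given by tight sets\<close>

lemma wedge_form_perturbed_form:
  "wedge_form a b i j v = perturbed_form a b (\<lambda>_ _. 0) (i, j) (wedge_point v)"
  by (simp add: wedge_form_def perturbed_form_def wedge_point_def)

lemma wedge_product_feasible:
  "wedge_product p a b
     = feasible (\<lambda>r v. perturbed_form a b (\<lambda>_ _. 0) r (wedge_point v)) ({..<p} \<times> {..<2})"
  by (auto simp: wedge_product_def feasible_def wedge_form_perturbed_form)

text \<open>At the point \<open>z\<close> of \<open>face_eq_tight_superset\<close> only those
  constraints are tight that are tight on all of \<open>F\<close>, so the tight set of
  \<open>z\<close> can be read off from the face vector.\<close>

lemma surface_polygon_tight:
  fixes a :: "nat \<Rightarrow> real ^ 2" and F :: "(real ^ 'n::{finite,linorder}) set"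
  assumes F: "F \<in> surface_polygons p a b"
  defines "f \<equiv> \<lambda>r (v :: real ^ 'n::{finite,linorder}). perturbed_form a b (\<lambda>_ _. 0) r (wedge_point v)"
  obtains s where "\<And>i. i < p \<Longrightarrow> s i < 2"
    "F = {w \<in> wedge_product p a b. (\<lambda>i. (i, s i)) ` {..<p} \<subseteq> tight f ({..<p} \<times> {..<2}) w}"
proof -
  define R :: "(nat \<times> nat) set" where "R = {..<p} \<times> {..<2}"
  have W: "wedge_product p a b = feasible f R"
    by (simp add: f_def R_def wedge_product_feasible)
  have face: "F face_of feasible f R" and "F \<noteq> {}"
    and "\<forall>i<p. \<exists>j<2. face_vector a b F i = {j}"
    using F by (auto simp: surface_polygons_def W)
  then obtain s where s: "\<And>i. i < p \<Longrightarrow> s i < 2" "\<And>i. i < p \<Longrightarrow> face_vector a b F i = {s i}"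
    by metis
  have lin: "\<And>r. r \<in> R \<Longrightarrow> linear (f r)"
    by (simp add: f_def linear_perturbed_form_wedge_point)
  obtain z where z: "z \<in> F" and Fz: "F = {w \<in> feasible f R. tight f R z \<subseteq> tight f R w}"
    using face_eq_tight_superset[OF _ lin face \<open>F \<noteq> {}\<close>] by (auto simp: R_def)
  have "(i, j) \<in> tight f R z \<longleftrightarrow> j = s i" if "i < p" "j < 2" for i j
  proof -
    have "(i, j) \<in> tight f R z \<longleftrightarrow> F \<subseteq> wedge_hyperplane a b i j"
    proof
      assume "(i, j) \<in> tight f R z"
      then show "F \<subseteq> wedge_hyperplane a b i j"
        using Fz by (auto simp: tight_def wedge_hyperplane_def wedge_form_perturbed_form f_def)
    next
      assume "F \<subseteq> wedge_hyperplane a b i j"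
      then show "(i, j) \<in> tight f R z"
        using z that by (auto simp: tight_def wedge_hyperplane_def wedge_form_perturbed_form f_def R_def)
    qed
    also have "\<dots> \<longleftrightarrow> j \<in> face_vector a b F i"
      using that by (simp add: face_vector_def)
    finally show ?thesis
      using s(2)[OF that(1)] by simp
  qed
  moreover have "tight f R z \<subseteq> {..<p} \<times> {..<2}"
    by (auto simp: tight_def R_def)
  ultimately have "tight f R z = (\<lambda>i. (i, s i)) ` {..<p}"
    using s(1) by auto
  then show thesis
    using that[of s] s(1) Fz by (simp add: W R_def)
qed

lemma inclusion_iso_subset:
  assumes "inclusion_iso \<phi> C D" "S \<subseteq> C"
  shows "inclusion_iso \<phi> S (\<phi> ` S)"
  using assms unfolding inclusion_iso_def bij_betw_def by (meson inj_on_subset subsetD)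

lemma inclusion_iso_comp:
  assumes "inclusion_iso \<phi> C D" "inclusion_iso \<psi> D E"
  shows "inclusion_iso (\<lambda>F. \<psi> (\<phi> F)) C E"
proof -
  have "bij_betw (\<psi> \<circ> \<phi>) C E"
    using assms bij_betw_trans[of \<phi> C D \<psi> E] by (simp add: inclusion_iso_def)
  moreover have "\<phi> F \<in> D" if "F \<in> C" for F
    using assms(1) that by (auto simp: inclusion_iso_def bij_betw_def)
  ultimately show ?thesis
    using assms by (simp add: inclusion_iso_def o_def)
qed

lemma last4_eq_imp_last3_eq: "last4 v = last4 w \<Longrightarrow> last3 v = last3 w"
  by (simp add: last4_def last3_def vec_eq_iff forall_4 forall_3)

section \<open>The projections of the surface\<close>

theorem theorem4p5:
  fixes p :: nat and a :: "nat \<Rightarrow> real ^ 2" and b :: "nat \<Rightarrow> real"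
    and W :: "(real ^ 'n::{finite,linorder}) set"
    and S :: "(real ^ 'n::{finite,linorder}) set set"
  assumes "p \<ge> 3"
    and "CARD('n) = 2 + p"
    and "cyclic_polygon p a"
    and "interval_presentation b"
    and "W = wedge_product p a b"
    and "S = wedge_surface p a b"
  shows "\<exists>(Q :: (real ^ 'n::{finite,linorder}) set) \<phi>.
           polytope Q \<and> inclusion_iso \<phi> (face_lattice W) (face_lattice Q) \<and>
           (\<forall>G\<in>S. preserved last4 Q (\<phi> G)) \<and>
           (\<forall>G\<in>S. preserved_in_complex last3 (\<phi> ` S) (\<phi> G)) \<and>
           (let f = (\<lambda>G. last4 ` \<phi> G) in
              polytope (last4 ` Q) \<and>
              polytopal_complex (f ` S) \<and> f ` S \<subseteq> boundary_complex (last4 ` Q) \<and>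
              inclusion_iso f S (f ` S)) \<and>
           (let f = (\<lambda>G. last3 ` \<phi> G) in
              polytopal_complex (f ` S) \<and>
              inclusion_iso f S (f ` S) \<and>
              (\<exists>g. homeomorphism (\<Union>(\<phi> ` S)) (\<Union>(f ` S)) last3 g))"
proof -

  \<comment> \<open>Choice of the perturbation\<close>
  note card = assms(2)
  interpret wedge_base p a b
    using assms by (intro cyclic_polygon_wedge_base)
  define q where "q = p - 2"
  have p: "p = Suc (Suc q)"
    using assms(1) by (simp add: q_def)
  define R :: "(nat \<times> nat) set" where "R = {..<p} \<times> {..<2}"
  obtain M where bd: "\<forall>\<^sub>F e in at_right 0. \<forall>l z. lower_small l e \<longrightarrow>
      z \<in> feasible (perturbed_form a b l) R \<longrightarrow> norm (fst z) \<le> M \<and> (\<forall>i<p. \<bar>snd z i\<bar> \<le> M)"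
    using feasible_bound unfolding R_def by blast
  have "\<forall>\<^sub>F e in at_right 0. e > 0 \<and>
      (\<forall>l z. lower_small l e \<longrightarrow> z \<in> feasible (perturbed_form a b l) R
        \<longrightarrow> norm (fst z) \<le> M \<and> (\<forall>i<p. \<bar>snd z i\<bar> \<le> M)) \<and>
      (\<forall>l. lower_small l e \<longrightarrow> tight (perturbed_form a b l) R ` feasible (perturbed_form a b l) R
        = tight (perturbed_form a b (\<lambda>_ _. 0)) R ` feasible (perturbed_form a b (\<lambda>_ _. 0)) R)"
    using bd eventually_tight_sets_eq eventually_at_right_less[of "0::real"]
    unfolding R_def by eventually_elim blast
  then obtain e where e: "e > 0"
    and bd: "\<And>l z. lower_small l e \<Longrightarrow> z \<in> feasible (perturbed_form a b l) R \<Longrightarrow>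
        norm (fst z) \<le> M \<and> (\<forall>i<p. \<bar>snd z i\<bar> \<le> M)"
    and tight_eq: "\<And>l. lower_small l e \<Longrightarrow>
        tight (perturbed_form a b l) R ` feasible (perturbed_form a b l) R
        = tight (perturbed_form a b (\<lambda>_ _. 0)) R ` feasible (perturbed_form a b (\<lambda>_ _. 0)) R"
    using eventually_happens[of _ "at_right (0::real)"] trivial_limit_at_right_real by blast
  define B where "B = \<bar>b 0\<bar> + \<bar>b 1\<bar>"
  have b_nz: "b 0 \<noteq> 0" "b 1 \<noteq> 0"
    using opposite_signs by auto
  then have B: "B > 0"
    by (simp add: B_def)
  have b_le: "\<bar>b j\<bar> \<le> B" "b j \<noteq> 0" if "j < 2" for j
    using that b_nz by (auto simp: less_2_cases_iff B_def)
  \<comment> \<open>The bound \<open>e / (4 * B)\<close> makes the geometric sequence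
    \<open>d\<close> grow as \<open>shear_positive_weights\<close> demands, with 4 in place of 2 for
    strictness; the bound 1 keeps \<open>d k \<le> e\<close>.\<close>
  define r where "r = min 1 (e / (4 * B))"
  have r: "0 < r" "r \<le> 1" "4 * B * r \<le> e"
    using e B by (auto simp: r_def min_def field_simps)
  define d where "d k = e * r ^ (q - k)" for k
  have d_pos: "d k > 0" for k
    using e r by (simp add: d_def)
  have growth: "2 * B * d k < e * d (Suc k)" if "k < q" for k
  proof -
    have "d k = r * d (Suc k)"
      using that by (simp add: d_def Suc_diff_Suc[symmetric])
    moreover have "(4 * B * r) * d (Suc k) \<le> e * d (Suc k)"
      using r(3) d_pos[of "Suc k"] by (intro mult_right_mono) auto
    moreover have "B * r * d (Suc k) > 0"
      using B r d_pos by simp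
    ultimately show ?thesis
      by simp
  qed
  define l where "l = shear q e d"
  have l: "lower_small l e"
  proof -
    have "d k \<le> e" for k
      using e r power_le_one[of r "q - k"] by (simp add: d_def mult_left_le)
    then show ?thesis
      using d_pos e by (auto simp: lower_small_def l_def shear_def less_imp_le)
  qed

  \<comment> \<open>The realization and its face lattice\<close>
  define f where "f = (\<lambda>r (v :: real ^ 'n::{finite,linorder}). perturbed_form a b (\<lambda>_ _. 0) r (wedge_point v))"
  define g where "g = (\<lambda>r (v :: real ^ 'n::{finite,linorder}). perturbed_form a b l r (deformed_point p v))"
  have linf: "\<And>r. linear (f r)" and ling: "\<And>r. linear (g r)"
    by (simp_all add: f_def g_def linear_perturbed_form_wedge_point linear_perturbed_form_deformed_point)
  have finR: "finite R"
    by (simp add: R_def)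
  have W: "W = feasible f R"
    using assms(5) by (simp add: f_def R_def wedge_product_feasible)
  define Q where "Q = feasible g R"
  define \<phi> where "\<phi> = tight_transfer f g R"
  have fg: "tight f R ` feasible f R = tight g R ` feasible g R"
    unfolding f_def g_def R_def
    by (simp only: tight_image_wedge_point[OF card] tight_image_deformed_point[OF card]
        tight_eq[OF l, unfolded R_def])
  have iso: "inclusion_iso \<phi> (face_lattice W) (face_lattice Q)"
    unfolding \<phi>_def W Q_def by (rule inclusion_iso_tight_transfer[OF finR linf ling fg])
  have "bounded Q"
    unfolding Q_def g_def by (rule bounded_deformed[OF card bd[OF l]])
  then have Q: "polytope Q"
    using polyhedron_feasible[OF finR ling] by (simp add: polytope_eq_bounded_polyhedron Q_def)
  have cvxQ: "convex Q"
    using Q polytope_imp_convex by blast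

  \<comment> \<open>Exposing functionals of the polygons\<close>
  define polygon where
    "polygon s = {w \<in> Q. (\<lambda>i. (i, s i)) ` {..<p} \<subseteq> tight g R w}" for s :: "nat \<Rightarrow> nat"
  define valid where "valid s \<longleftrightarrow> (\<forall>i<p. s i < 2)" for s :: "nat \<Rightarrow> nat"
  have sR: "(\<lambda>i. (i, s i)) ` {..<p} \<subseteq> R" if "valid s" for s
    using that by (auto simp: valid_def R_def)
  have polygon_face: "polygon s face_of Q" if "valid s" for s
    unfolding polygon_def Q_def by (rule tight_superset_face_of[OF ling sR[OF that]])
  have functional: "\<exists>c m. c $ 1 < 0 \<and> (\<forall>w\<in>Q. c \<bullet> last4 w \<le> m) \<and> polygon s = {w \<in> Q. c \<bullet> last4 w = m}"
    if s: "valid s" for s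
  proof -
    \<comment> \<open>The bound on \<open>b (s i)\<close> is demanded for every \<open>i\<close>, so
      \<open>s\<close> is continued by 0 from \<open>p\<close> on.\<close>
    define s' where "s' i = (if i < p then s i else 0)" for i
    have s': "s' i < 2" for i
      using s by (simp add: s'_def valid_def)
    obtain \<kappa> c where \<kappa>: "\<And>i. i < p \<Longrightarrow> \<kappa> i > 0" and c: "c $ 1 < 0"
      "\<And>v :: real ^ 'n::{finite,linorder}. c \<bullet> last4 v = (\<Sum>i<p. \<kappa> i * perturbed_form a b (shear q e d) (i, s' i) (deformed_point p v))"
      using shear_functional_last4[where b = b and s = s' and d = d and a = a,
          OF card p e B b_le(1)[OF s'] d_pos growth] by blast
    have cg: "c \<bullet> last4 v = (\<Sum>i<p. \<kappa> i * g (i, s i) v)" for v :: "real ^ 'n::{finite,linorder}"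
      unfolding c(2) by (intro sum.cong) (simp_all add: g_def l_def s'_def)
    have "c \<bullet> last4 w \<le> sum \<kappa> {..<p} \<and>
        (c \<bullet> last4 w = sum \<kappa> {..<p} \<longleftrightarrow> (\<lambda>i. (i, s i)) ` {..<p} \<subseteq> tight g R w)" if "w \<in> Q" for w
      using positive_combination_face[of "{..<p}" \<kappa> s R w g] \<kappa> sR[OF s] that
      unfolding cg Q_def by simp
    then show ?thesis
      using c(1) by (intro exI[of _ c] exI[of _ "sum \<kappa> {..<p}"]) (auto simp: polygon_def)
  qed
  have determined: "v = w"
    if s: "valid s" and vw: "v \<in> polygon s" "w \<in> polygon s" and eq: "last3 v = last3 w" for s v w
  proof (rule deformed_polygon_determined[OF card, of b s a l])
    show "b (s i) \<noteq> 0" if "i < p" for i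
      using s b_le that by (simp add: valid_def)
    show "perturbed_form a b l (i, s i) (deformed_point p v) = 1"
      "perturbed_form a b l (i, s i) (deformed_point p w) = 1" if "i < p" for i
      using vw that by (auto simp: polygon_def tight_def g_def)
    have "CARD('n) - 2 = p" "CARD('n) - 1 = Suc p"
      using card by auto
    then show "coord p v = coord p w" "coord (Suc p) v = coord (Suc p) w"
      using eq by (auto simp: last3_def vec_eq_iff forall_3)
  qed

  \<comment> \<open>The surface as a complex of faces of the realization\<close>
  define K where "K = \<phi> ` S"
  have \<phi>_polygon: "\<exists>s. valid s \<and> \<phi> F = polygon s" if F: "F \<in> surface_polygons p a b" for F
  proof -
    obtain s where "\<And>i. i < p \<Longrightarrow> s i < 2"
      "F = {w \<in> W. (\<lambda>i. (i, s i)) ` {..<p} \<subseteq> tight f R w}"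
      using surface_polygon_tight[OF F] unfolding f_def R_def assms(5) by blast
    then show ?thesis
      using tight_transfer_tight_superset[OF fg]
      by (auto simp: valid_def \<phi>_def W polygon_def Q_def intro!: exI[of _ s])
  qed
  \<comment> \<open>The map \<open>\<phi>\<close> only respects inclusion. Between faces of one
    convex set, inclusion already means being a face, so facial relations can be carried over
    through it.\<close>
  have mono: "F \<subseteq> G \<longleftrightarrow> \<phi> F \<subseteq> \<phi> G" if "F face_of W" "G face_of W" for F G
    using iso that by (simp add: inclusion_iso_def face_lattice_def)
  have \<phi>_face: "\<phi> F face_of Q" if "F face_of W" for F
    using iso that by (auto simp: inclusion_iso_def face_lattice_def bij_betw_def)
  have \<phi>_surj: "\<exists>F. F face_of W \<and> Y = \<phi> F" if "Y face_of Q" for Y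
  proof -
    have "Y \<in> \<phi> ` face_lattice W"
      using iso that unfolding inclusion_iso_def bij_betw_def by (simp add: face_lattice_def)
    then show ?thesis
      by (auto simp: face_lattice_def)
  qed
  have \<phi>_empty: "\<phi> F = {} \<longleftrightarrow> F = {}" if "F face_of W" for F
    using mono[OF that empty_face_of] by (simp add: \<phi>_def)
  have surface_face: "F face_of W" if "F \<in> surface_polygons p a b" for F
    using that assms(5) by (simp add: surface_polygons_def)
  have S: "G \<noteq> {} \<and> G face_of W \<and> (\<exists>F\<in>surface_polygons p a b. G face_of F)" if "G \<in> S" for G
    using that assms(6) surface_face face_of_trans by (auto simp: wedge_surface_def)
  have face_K: "X \<noteq> {} \<and> X face_of Q \<and> (\<exists>s. valid s \<and> X face_of polygon s)" if XK: "X \<in> K" for X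
  proof -
    obtain G where G: "G \<in> S" "X = \<phi> G"
      using XK by (auto simp: K_def)
    then obtain F where F: "F \<in> surface_polygons p a b" "G face_of F"
      using S by blast
    obtain s where s: "valid s" "\<phi> F = polygon s"
      using \<phi>_polygon[OF F(1)] by blast
    have X: "X face_of Q"
      using G S \<phi>_face by blast
    have "X \<subseteq> polygon s"
      using mono[of G F] S[OF G(1)] surface_face[OF F(1)] face_of_imp_subset[OF F(2)] G(2) s(2) by simp
    then have "X face_of polygon s"
      using face_of_subset[OF X] face_of_imp_subset[OF polygon_face[OF s(1)]] by blast
    then show ?thesis
      using X s(1) S[OF G(1)] \<phi>_empty G(2) by blast
  qed
  have "Y \<in> K" if X: "X \<in> K" and Y: "Y face_of X" "Y \<noteq> {}" for X Y
  proof -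
    obtain G where G: "G \<in> S" "X = \<phi> G"
      using X by (auto simp: K_def)
    have "Y face_of Q"
      using face_of_trans[OF Y(1)] face_K[OF X] by blast
    then obtain H where H: "H face_of W" "Y = \<phi> H"
      using \<phi>_surj by blast
    obtain F where F: "F \<in> surface_polygons p a b" "G face_of F"
      using S[OF G(1)] by blast
    have "H \<subseteq> G"
      using mono[OF H(1), of G] S[OF G(1)] face_of_imp_subset[OF Y(1)] G(2) H(2) by simp
    then have "H face_of G"
      using face_of_subset[OF H(1)] S[OF G(1)] face_of_imp_subset by blast
    then have "H face_of F"
      using F(2) face_of_trans by blast
    moreover have "H \<noteq> {}"
      using Y(2) H \<phi>_empty by blast
    ultimately have "H \<in> S"
      using F(1) assms(6) by (auto simp: wedge_surface_def)
    then show ?thesis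
      using H(2) by (simp add: K_def)
  qed
  moreover have "finite K"
    by (rule finite_subset[OF _ finite_polytope_faces[OF Q]]) (use face_K in blast)
  moreover have "polytope X \<and> X \<noteq> {}" if "X \<in> K" for X
    using face_K[OF that] face_of_polytope_polytope[OF Q] by blast
  moreover have "X \<inter> Y face_of X \<and> X \<inter> Y face_of Y" if "X \<in> K" "Y \<in> K" for X Y
  proof -
    have "X face_of Q" "Y face_of Q"
      using that face_K by blast+
    then show ?thesis
      by (meson face_of_Int face_of_imp_subset face_of_subset inf_le1 inf_le2)
  qed
  ultimately have K: "polytopal_complex K"
    unfolding polytopal_complex_def by blast

  \<comment> \<open>Injectivity on the surface\<close>
  have inj3: "inj_on last3 (\<Union>K)"
  proof (rule inj_onI)
    fix v w assume v: "v \<in> \<Union>K" and w: "w \<in> \<Union>K" and eq: "last3 v = last3 w"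
    obtain s where s: "valid s" "v \<in> polygon s"
      using v face_K face_of_imp_subset by blast
    obtain t where t: "valid t" "w \<in> polygon t"
      using w face_K face_of_imp_subset by blast
    have vw: "v \<in> Q" "w \<in> Q"
      using s t by (auto simp: polygon_def)
    have card4: "CARD('n) = 4 + q"
      using card p by simp
    have "CARD('n) - 3 = Suc q" "CARD('n) - 2 = Suc (Suc q)" "CARD('n) - 1 = Suc (Suc (Suc q))"
      using card4 by auto
    \<comment> \<open>Where \<open>last3\<close> agrees, \<open>last4\<close> can differ only in
      coordinate \<open>q\<close>.\<close>
    then have diff: "c \<bullet> last4 v - c \<bullet> last4 w = c $ 1 * (coord q v - coord q w)" for c
      using eq by (simp add: inner_last4[OF card4] last3_def vec_eq_iff forall_3 right_diff_distrib)
    obtain c m where c: "c $ 1 < 0" "\<forall>w\<in>Q. c \<bullet> last4 w \<le> m" "polygon s = {w \<in> Q. c \<bullet> last4 w = m}"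
      using functional[OF s(1)] by blast
    obtain c' m' where c': "c' $ 1 < 0" "\<forall>w\<in>Q. c' \<bullet> last4 w \<le> m'" "polygon t = {w \<in> Q. c' \<bullet> last4 w = m'}"
      using functional[OF t(1)] by blast
    have cv: "c \<bullet> last4 v = m" "c \<bullet> last4 w \<le> m" and cw: "c' \<bullet> last4 w = m'" "c' \<bullet> last4 v \<le> m'"
      using s t c c' vw by auto
    \<comment> \<open>\<open>v\<close> maximizes \<open>c\<close> and \<open>w\<close> maximizes
      \<open>c'\<close> over \<open>Q\<close>, and both functionals decrease in coordinate
      \<open>q\<close>, so neither point lies above the other. Then \<open>w\<close> maximizes
      \<open>c\<close> too and shares the polygon of \<open>v\<close>.\<close>
    have "c $ 1 * (coord q v - coord q w) \<ge> 0" "c' $ 1 * (coord q v - coord q w) \<le> 0"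
      using diff[of c] diff[of c'] cv cw by linarith+
    then have "coord q v = coord q w"
      using c(1) c'(1) by (auto simp: zero_le_mult_iff mult_le_0_iff)
    then have "c \<bullet> last4 w = m"
      using diff[of c] cv by simp
    then have "w \<in> polygon s"
      using c vw by simp
    then show "v = w"
      using determined s eq by blast
  qed
  have inj4: "inj_on last4 (\<Union>K)"
    using inj3 last4_eq_imp_last3_eq unfolding inj_on_def by blast
  note complex3 = polytopal_complex_linear_image[OF K linear_last3 inj3]
  note complex4 = polytopal_complex_linear_image[OF K linear_last4 inj4]
  have isoS: "inclusion_iso \<phi> S K"
    unfolding K_def using iso S by (intro inclusion_iso_subset) (auto simp: face_lattice_def)

  \<comment> \<open>Preservation and boundary position in dimension four\<close>
  have preserved4: "preserved last4 Q X" if X: "X \<in> K" for X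
  proof -
    obtain s where s: "valid s" "X face_of polygon s"
      using face_K[OF X] by blast
    obtain c m where "\<forall>w\<in>Q. c \<bullet> last4 w \<le> m" "polygon s = {w \<in> Q. c \<bullet> last4 w = m}"
      using functional[OF s(1)] by blast
    moreover have "inj_on last4 (polygon s)"
      using determined[OF s(1)] last4_eq_imp_last3_eq unfolding inj_on_def by blast
    ultimately show ?thesis
      using preserved_subface[OF linear_last4 cvxQ polygon_face[OF s(1)], of c m X] s(2) face_K[OF X]
      by blast
  qed
  have "last4 ` X \<in> boundary_complex (last4 ` Q)" if X: "X \<in> K" for X
  proof -
    have "last4 ` X \<noteq> last4 ` Q"
    proof
      assume eq: "last4 ` X = last4 ` Q"
      \<comment> \<open>Only \<open>X\<close> is mapped onto its image, so equal images would put
        all of \<open>Q\<close> into one polygon; but the origin is in \<open>Q\<close>, and every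
        form vanishes there.\<close>
      have "last4 -` (last4 ` X) \<inter> Q = X"
        using preserved4[OF X] by (simp add: preserved_def)
      then have "Q \<subseteq> X"
        unfolding eq by blast
      moreover have "0 \<in> Q"
        by (simp add: Q_def feasible_def linear_0[OF ling])
      moreover obtain s where s: "valid s" "X \<subseteq> polygon s"
        using face_K[OF X] face_of_imp_subset by blast
      ultimately have "0 \<in> polygon s"
        by blast
      then have "g (0, s 0) 0 = 1"
        using p by (auto simp: polygon_def tight_def)
      then show False
        using linear_0[OF ling] by simp
    qed
    then show ?thesis
      using preserved4[OF X] by (auto simp: boundary_complex_def preserved_def)
  qed
  then have boundary: "(\<lambda>G. last4 ` \<phi> G) ` S \<subseteq> boundary_complex (last4 ` Q)"
    by (auto simp: K_def)
  have image4: "(\<lambda>G. last4 ` \<phi> G) ` S = (`) last4 ` K"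
    and image3: "(\<lambda>G. last3 ` \<phi> G) ` S = (`) last3 ` K"
    by (simp_all add: K_def image_image)
  have iso4: "inclusion_iso (\<lambda>G. last4 ` \<phi> G) S ((`) last4 ` K)"
    and iso3: "inclusion_iso (\<lambda>G. last3 ` \<phi> G) S ((`) last3 ` K)"
    using inclusion_iso_comp[OF isoS] inclusion_iso_image_inj[OF inj3] inclusion_iso_image_inj[OF inj4]
    by blast+
  show ?thesis
    unfolding Let_def
  proof (intro exI[of _ Q] exI[of _ \<phi>] conjI ballI)
    show "preserved last4 Q (\<phi> G)" if "G \<in> S" for G
      using preserved4 that by (simp add: K_def)
    show "preserved_in_complex last3 (\<phi> ` S) (\<phi> G)" if "G \<in> S" for G
      using complex3(2)[of "\<phi> G"] that by (simp add: K_def)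
  qed (use Q iso complex3 complex4 iso3 iso4 boundary polytope_linear_image[OF linear_last4 Q] in
        \<open>simp_all add: image3 image4 K_def[symmetric]\<close>)
qed

end
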